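(* Let $n\ge 1$, $\mathcal M=\{0,1,\dots,M-1\}$, $\widehat{\mathcal M}=\{0,1,\dots,\widehat M-1\}$, and let $\{\Omega_i\}_{i\in\mathcal M}$ and $\{\widehat\Omega_{\widehat i}\}_{\widehat i\in\widehat{\mathcal M}}$ be two partitions of $\mathbb R^n$ into pairwise disjoint domains separated by smooth boundaries. Consider the piecewise affine plant $$\dot x=A_i x+Bu+B_i\quad\text{if } x\in\Omega_i,\ i\in\mathcal M,$$ with scalar input $u$, and the piecewise affine reference model $$\dot{\widehat x}=\widehat A_{\widehat i}\,\widehat x+\widehat B r+\widehat B_{\widehat i}\quad\text{if }\widehat x\in\widehat\Omega_{\widehat i},\ \widehat i\in\widehat{\mathcal M},$$ with scalar input $r$, where $A_i,\widehat A_{\widehat i}\in\mathbb R^{n\times n}$ are in companion form (ones on the superdiagonal, arbitrary last row, all other entries zero), $B=b\,e_n$, $B_i=b_i e_n$, $\widehat B=\widehat b\,e_n$, $\widehat B_{\widehat i}=\widehat b_{\widehat i}e_n$, $b>0$, $\widehat b>0$, $b_i,\widehat b_{\widehat i}\in\mathbb R$, and $e_n=(0,\dots,0,1)^T$. Assume that the reference model is well-posed for the given initial condition $\widehat x(0)=\widehat x_0$ and has no sliding solutions, and that there is a matrix $P=P^T>0$ with $$P\widehat A_{\widehat i}+\widehat A_{\widehat i}^TP<0\qquad\text{for all }\widehat i\in\widehat{\mathcal M}.$$ Let $\alpha,\beta,\rho>0$ be constants, put $x_e=\widehat x-x$ and $y_e=e_n^TPx_e$, and apply to the plant the control law $$u(t)=K_R(t)r(t)+K_{FB}(t)x(t)+K_A(t),$$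 $$K_R(t)=\alpha\int_0^t y_e(\tau) r(\tau)\,d\tau+\beta y_e(t)r(t),$$ $$K_{FB}(t)=K_0(t)+\sum_{j=1}^{M-1}K_j(t)+\sum_{\widehat j=1}^{\widehat M-1}\widehat K_{\widehat j}(t),\qquad K_0(t)=\alpha\int_0^t y_e(\tau) x^T(\tau)\,d\tau+\beta y_e(t)x^T(t),$$ $$K_A(t)=K_{0A}(t)+\sum_{j=1}^{M-1}K_{Aj}(t)+\sum_{\widehat j=1}^{\widehat M-1}\widehat K_{A\widehat j}(t),\qquad K_{0A}(t)=\rho\int_0^t y_e(\tau)\,d\tau,$$ where $K_j,\widehat K_{\widehat j}$ (row vectors) and $K_{Aj},\widehat K_{A\widehat j}$ (scalars) are the switched integral gains, with memory, with integrands $\rho y_e x^T$ and $\rho y_e$ respectively, active when $x\in\Omega_j$ (for $K_j,K_{Aj}$) or $\widehat x\in\widehat\Omega_{\widehat j}$ (for $\widehat K_{\widehat j},\widehat K_{A\widehat j}$), as specified in the context. Then, for all initial conditions, the state tracking error of the closed-loop system (with solutions understood in the sense of Filippov, sliding motions of the plant being allowed) converges asymptotically to zero: $$\lim_{t\to\infty}x_e(t)=0 .$$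
   Context: **Indicator functions.** $\sigma_j(t)=1$ if $x(t)\in\Omega_j$ and $0$ otherwise; $\widehat\sigma_{\widehat j}(t)=1$ if $\widehat x(t)\in\widehat\Omega_{\widehat j}$ and $0$ otherwise. The numbers of modes $M$ and $\widehat M$ may differ; $\widehat M=1$ (a single-mode reference model, e.g. LTI) is allowed. Sums over an empty index set are zero. **Switched gains.** Let $t_{j_1}<t_{j_2}<\cdots$ be the times at which the plant enters mode $j$ (i.e. $x$ enters $\Omega_j$), and let $t_{j_s+1}$ be the time at which it leaves mode $j$ after the $s$-th entry. Define $\widehat t_{\widehat j_s}$ and $\widehat t_{\widehat j_s+1}$ analogously for $\widehat x$ and $\widehat\Omega_{\widehat j}$. For $j=1,\dots,M-1$, while $x\in\Omega_j$ after the $s$-th entry, the gains $K_j$ and $K_{Aj}$ are obtained by integrating $\rho y_e x^T$ and $\rho y_e$, respectively, from $t_{j_s}$ to $t$, starting from the values $K_j(t_{j_s})$ and $K_{Aj}(t_{j_s})$. Here $K_j(t_{j_1})=0$, $K_{Aj}(t_{j_1})=0$, and, for $s\ge 2$, $K_j(t_{j_s})=K_j(t_{j_{s-1}+1})$ and $K_{Aj}(t_{j_s})=K_{Aj}(t_{j_{s-1}+1})$ (the last value taken before leaving $\Omega_j$). While $x\notin\Omega_j$ these gains contribute $0$ to the control. The gains $\widehat K_{\widehat j},\widehat K_{A\widehat j}$ ($\widehat j=1,\dots,\widehat M-1$) are defined in the same way with the same integrands $\rho y_e x^T$ and $\rho y_e$, but with $\widehat x\in\widehat\Omega_{\widehat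 j}$ and the times $\widehat t_{\widehat j_s}$. Equivalently: there are stored gain states, denoted by the same symbols, with zero initial values and $$\dot K_j=\rho y_e x^T\sigma_j,\quad \dot K_{Aj}=\rho y_e\sigma_j,\quad \dot{\widehat K}_{\widehat j}=\rho y_e x^T\widehat\sigma_{\widehat j},\quad \dot{\widehat K}_{A\widehat j}=\rho y_e\widehat\sigma_{\widehat j},$$ and the contributions to the control are $\sigma_jK_j$, $\sigma_jK_{Aj}$, $\widehat\sigma_{\widehat j}\widehat K_{\widehat j}$, $\widehat\sigma_{\widehat j}\widehat K_{A\widehat j}$. The integral parts of $K_R$, $K_0$ and $K_{0A}$ also start from zero at $t=0$. **Closed-loop solutions.** The closed-loop state $z$ consists of $x_e$ and all the stored (integral) adaptive gain states. For the given reference trajectory, $\dot z=f_i$ when $x=\widehat x(t)-x_e\in\Omega_i$, where $f_i$ is the right-hand side of the closed-loop equations (error dynamics and gain dynamics) with $\sigma_i=1$ and $\sigma_j=0$ for $j\ne i$. Solutions are taken in the sense of Filippov: where the plant state stays on boundaries of the regions $\Omega_i$ (sliding), the vector field is a convex combination $\sum_{i=0}^{M-1}\gamma_i f_i$ with $\gamma_i\ge0$, $\sum_i\gamma_i=1$. No particular choice of Filippov sliding vector field is imposed. Only the discontinuities caused by the plant's switching are convexified, since the reference model has no sliding. *)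

theory Defs
  imports "HOL-Analysis.Analysis"
begin

(* The coordinates of the state space are indexed by a finite linear order, so that "last
   coordinate" and "superdiagonal" make sense; its cardinality is n. *)

type_synonym 'n rvec = "(real, 'n) vec"
type_synonym 'n rmat = "('n rvec, 'n) vec"

definition e_last :: "'n::{finite,linorder} rvec" where
  "e_last = axis (Max UNIV) 1"

definition next_index :: "'n::linorder \<Rightarrow> 'n \<Rightarrow> bool" where
  "next_index i j \<longleftrightarrow> i < j \<and> (\<forall>k. i < k \<longrightarrow> j \<le> k)"

definition companion_form :: "'n::{finite,linorder} rmat \<Rightarrow> bool" where
  "companion_form A \<longleftrightarrow>
     (\<forall>i j. i \<noteq> Max UNIV \<longrightarrow> A $ i $ j = (if next_index i j then 1 else 0))"

definition pos_def :: "'n::finite rmat \<Rightarrow> bool" where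
  "pos_def Q \<longleftrightarrow> transpose Q = Q \<and> (\<forall>x. x \<noteq> 0 \<longrightarrow> 0 < x \<bullet> (Q *v x))"

definition neg_def :: "'n::finite rmat \<Rightarrow> bool" where
  "neg_def Q \<longleftrightarrow> pos_def (- Q)"


(* Near each of its points, the set is contained in the regular zero set of a C^1 function.
   Containment rather than equality lets a boundary end at a junction with other boundaries. *)

definition in_smooth_hypersurface :: "'n::finite rvec set \<Rightarrow> bool" where
  "in_smooth_hypersurface \<Sigma> \<longleftrightarrow>
     (\<forall>p\<in>\<Sigma>. \<exists>U h g. open U \<and> p \<in> U \<and>
        (\<forall>y\<in>U. ((h :: 'n rvec \<Rightarrow> real) has_derivative (\<lambda>v. g y \<bullet> v)) (at y)) \<and>
        continuous_on U g \<and> (\<forall>y\<in>U. g y \<noteq> 0) \<and>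
        \<Sigma> \<inter> U \<subseteq> {y. h y = 0})"

(* The regions are open, so the partition is up to the boundaries: a point outside all
   regions lies on the common boundary of two different ones. *)

definition domain_partition :: "nat \<Rightarrow> (nat \<Rightarrow> 'n::finite rvec set) \<Rightarrow> bool" where
  "domain_partition m \<Omega> \<longleftrightarrow>
     (\<forall>i<m. open (\<Omega> i) \<and> connected (\<Omega> i) \<and> \<Omega> i \<noteq> {}) \<and>
     (\<forall>i<m. \<forall>j<m. i \<noteq> j \<longrightarrow> \<Omega> i \<inter> \<Omega> j = {}) \<and>
     (\<forall>x. (\<exists>i<m. x \<in> \<Omega> i) \<or>
          (\<exists>i<m. \<exists>j<m. i \<noteq> j \<and> x \<in> closure (\<Omega> i) \<inter> closure (\<Omega> j))) \<and>
     (\<forall>i<m. \<forall>j<m. i \<noteq> j \<longrightarrow> in_smooth_hypersurface (closure (\<Omega> i) \<inter> closure (\<Omega> j)))"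

(* Data of a piecewise affine system x' = A_i x + (b u + b_i) e_n for x in region i < modes. *)

record 'n pwa =
  modes :: nat
  region :: "nat \<Rightarrow> 'n rvec set"
  sysmat :: "nat \<Rightarrow> 'n rmat"
  ingain :: real
  offset :: "nat \<Rightarrow> real"

definition pwa_system :: "'n::{finite,linorder} pwa \<Rightarrow> bool" where
  "pwa_system S \<longleftrightarrow>
     domain_partition (modes S) (region S) \<and>
     (\<forall>i<modes S. companion_form (sysmat S i)) \<and>
     0 < ingain S"

definition pwa_field ::
    "'n::{finite,linorder} pwa \<Rightarrow> nat \<Rightarrow> 'n rvec \<Rightarrow> real \<Rightarrow> 'n rvec" where
  "pwa_field S i x u =
     sysmat S i *v x + u *\<^sub>R (ingain S *\<^sub>R e_last) + offset S i *\<^sub>R e_last"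


(* x is locally absolutely continuous on [0,\<infinity>) with almost everywhere derivative v,
   written as an indefinite Lebesgue integral. *)

definition abs_cont_deriv ::
    "(real \<Rightarrow> 'a::euclidean_space) \<Rightarrow> (real \<Rightarrow> 'a) \<Rightarrow> bool" where
  "abs_cont_deriv x v \<longleftrightarrow>
     (\<forall>T\<ge>0. v absolutely_integrable_on {0..T} \<and> x T = x 0 + integral {0..T} v)"

(* Coefficients of the convex combinations in Filippov's set at x. In the interior of a region
   only its own vector field remains; on boundaries every combination of the vector fields
   of the adjacent regions is allowed. *)

definition filippov_weights :: "'n::finite pwa \<Rightarrow> 'n rvec \<Rightarrow> (nat \<Rightarrow> real) \<Rightarrow> bool" where
  "filippov_weights S x \<gamma> \<longleftrightarrow>
     (\<forall>i<modes S. 0 \<le> \<gamma> i) \<and> (\<Sum>i<modes S. \<gamma> i) = 1 \<and>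
     (\<forall>i<modes S. \<gamma> i \<noteq> 0 \<longrightarrow> x \<in> closure (region S i))"

definition pwa_solution ::
    "'n::{finite,linorder} pwa \<Rightarrow> (real \<Rightarrow> real) \<Rightarrow> (real \<Rightarrow> 'n rvec) \<Rightarrow> bool" where
  "pwa_solution S u x \<longleftrightarrow>
     (\<exists>\<gamma>. (AE t in lebesgue. 0 \<le> t \<longrightarrow> filippov_weights S (x t) (\<gamma> t)) \<and>
          abs_cont_deriv x (\<lambda>t. \<Sum>i<modes S. \<gamma> t i *\<^sub>R pwa_field S i (x t) (u t)))"

definition well_posed ::
    "'n::{finite,linorder} pwa \<Rightarrow> (real \<Rightarrow> real) \<Rightarrow> 'n rvec \<Rightarrow> bool" where
  "well_posed S u x0 \<longleftrightarrow>
     (\<exists>x. pwa_solution S u x \<and> x 0 = x0) \<and>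
     (\<forall>x y. pwa_solution S u x \<and> x 0 = x0 \<and> pwa_solution S u y \<and> y 0 = x0 \<longrightarrow>
        (\<forall>t\<ge>0. x t = y t))"

definition no_sliding ::
    "'n::{finite,linorder} pwa \<Rightarrow> (real \<Rightarrow> real) \<Rightarrow> 'n rvec \<Rightarrow> bool" where
  "no_sliding S u x0 \<longleftrightarrow>
     (\<forall>x. pwa_solution S u x \<and> x 0 = x0 \<longrightarrow>
        (AE t in lebesgue. 0 \<le> t \<longrightarrow> (\<exists>i<modes S. x t \<in> region S i)))"


(* Closed-loop state: tracking error and stored integral gains. The row-vector gains are
   column vectors here and act by the inner product. kP, kPA are the gains switched by the
   plant mode (K_j, K_Aj), kM, kMA those switched by the reference mode. *)

record 'n cl_state =
  err :: "'n rvec"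
  kR :: real
  k0 :: "'n rvec"
  k0A :: real
  kP :: "nat \<Rightarrow> 'n rvec"
  kPA :: "nat \<Rightarrow> real"
  kM :: "nat \<Rightarrow> 'n rvec"
  kMA :: "nat \<Rightarrow> real"

definition out_err :: "'n::{finite,linorder} rmat \<Rightarrow> 'n rvec \<Rightarrow> real" where
  "out_err P xe = e_last \<bullet> (P *v xe)"

(* s and sh are the values of the plant and reference indicator functions, w = r(t). *)

definition control ::
    "nat \<Rightarrow> nat \<Rightarrow> 'n::{finite,linorder} rmat \<Rightarrow> real \<Rightarrow> (nat \<Rightarrow> real) \<Rightarrow> (nat \<Rightarrow> real)
      \<Rightarrow> real \<Rightarrow> 'n rvec \<Rightarrow> 'n cl_state \<Rightarrow> real" where
  "control m mh P \<beta> s sh w x z =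
     (let y = out_err P (err z);
          KR = kR z + \<beta> * y * w;
          K0 = k0 z + (\<beta> * y) *\<^sub>R x;
          KFB = K0 + (\<Sum>j\<in>{1..<m}. s j *\<^sub>R kP z j) + (\<Sum>j\<in>{1..<mh}. sh j *\<^sub>R kM z j);
          KA = k0A z + (\<Sum>j\<in>{1..<m}. s j * kPA z j) + (\<Sum>j\<in>{1..<mh}. sh j * kMA z j)
      in KR * w + KFB \<bullet> x + KA)"

(* Right-hand side f_i of the closed loop at a time when the reference state is xh and the
   reference input is w. *)

definition cl_field ::
    "'n::{finite,linorder} pwa \<Rightarrow> 'n pwa \<Rightarrow> 'n rmat \<Rightarrow> real \<Rightarrow> real \<Rightarrow> real
      \<Rightarrow> real \<Rightarrow> 'n rvec \<Rightarrow> nat \<Rightarrow> 'n cl_state \<Rightarrow> 'n cl_state" where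
  "cl_field S R P \<alpha> \<beta> \<rho> w xh i z =
     (let x = xh - err z;
          y = out_err P (err z);
          s = (\<lambda>j. if j = i then 1 else 0);
          sh = (\<lambda>k. if xh \<in> region R k then 1 else 0);
          u = control (modes S) (modes R) P \<beta> s sh w x z
      in \<lparr> err = (\<Sum>k<modes R. sh k *\<^sub>R pwa_field R k xh w) - pwa_field S i x u,
           kR = \<alpha> * y * w,
           k0 = (\<alpha> * y) *\<^sub>R x,
           k0A = \<rho> * y,
           kP = (\<lambda>j. (\<rho> * y * s j) *\<^sub>R x),
           kPA = (\<lambda>j. \<rho> * y * s j),
           kM = (\<lambda>k. (\<rho> * y * sh k) *\<^sub>R x),
           kMA = (\<lambda>k. \<rho> * y * sh k) \<rparr>)"

(* Filippov solutions on [0,\<infinity>) for the reference trajectory xh, with the integral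
   gains starting from zero. The same coefficients \<gamma> apply to all components of the state. *)

definition closed_loop_solution ::
    "'n::{finite,linorder} pwa \<Rightarrow> 'n pwa \<Rightarrow> 'n rmat \<Rightarrow> real \<Rightarrow> real \<Rightarrow> real
      \<Rightarrow> (real \<Rightarrow> real) \<Rightarrow> (real \<Rightarrow> 'n rvec) \<Rightarrow> (real \<Rightarrow> 'n cl_state) \<Rightarrow> bool" where
  "closed_loop_solution S R P \<alpha> \<beta> \<rho> r xh z \<longleftrightarrow>
     kR (z 0) = 0 \<and> k0 (z 0) = 0 \<and> k0A (z 0) = 0 \<and>
     (\<forall>j\<in>{1..<modes S}. kP (z 0) j = 0 \<and> kPA (z 0) j = 0) \<and>
     (\<forall>k\<in>{1..<modes R}. kM (z 0) k = 0 \<and> kMA (z 0) k = 0) \<and>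
     (\<exists>\<gamma>. (AE t in lebesgue. 0 \<le> t \<longrightarrow> filippov_weights S (xh t - err (z t)) (\<gamma> t)) \<and>
        (let f = (\<lambda>t i. cl_field S R P \<alpha> \<beta> \<rho> (r t) (xh t) i (z t)) in
           abs_cont_deriv (\<lambda>t. err (z t)) (\<lambda>t. \<Sum>i<modes S. \<gamma> t i *\<^sub>R err (f t i)) \<and>
           abs_cont_deriv (\<lambda>t. kR (z t)) (\<lambda>t. \<Sum>i<modes S. \<gamma> t i * kR (f t i)) \<and>
           abs_cont_deriv (\<lambda>t. k0 (z t)) (\<lambda>t. \<Sum>i<modes S. \<gamma> t i *\<^sub>R k0 (f t i)) \<and>
           abs_cont_deriv (\<lambda>t. k0A (z t)) (\<lambda>t. \<Sum>i<modes S. \<gamma> t i * k0A (f t i)) \<and>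
           (\<forall>j\<in>{1..<modes S}.
              abs_cont_deriv (\<lambda>t. kP (z t) j) (\<lambda>t. \<Sum>i<modes S. \<gamma> t i *\<^sub>R kP (f t i) j) \<and>
              abs_cont_deriv (\<lambda>t. kPA (z t) j) (\<lambda>t. \<Sum>i<modes S. \<gamma> t i * kPA (f t i) j)) \<and>
           (\<forall>k\<in>{1..<modes R}.
              abs_cont_deriv (\<lambda>t. kM (z t) k) (\<lambda>t. \<Sum>i<modes S. \<gamma> t i *\<^sub>R kM (f t i) k) \<and>
              abs_cont_deriv (\<lambda>t. kMA (z t) k) (\<lambda>t. \<Sum>i<modes S. \<gamma> t i * kMA (f t i) k))))"

end

theory Submission
  imports Defs
begin

text \<open>
  With \<open>W = x\<^sub>e \<bullet> P x\<^sub>e\<close> and \<open>U\<close> a weighted sum of squares of the deviations of all stored gains from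
  their matching values, the Lyapunov function \<open>W + U\<close> satisfies
  \<open>(W + U)' \<le> - c \<bar>x\<^sub>e\<bar>\<^sup>2\<close> almost everywhere: a Filippov combination weights the gain adaptation
  and the control by the same coefficients, so the cross terms cancel also during sliding.
  Hence the error and the gains are bounded and \<open>W\<close> is integrable.
  Neither \<open>r\<close> nor the reference state need be bounded, so \<open>x\<^sub>e'\<close> may be unbounded and the usual
  form of Barbalat's lemma does not apply. However, the term \<open>- 2 b \<beta> y\<^sub>e\<^sup>2 (r\<^sup>2 + \<bar>x\<bar>\<^sup>2)\<close> produced
  by the proportional gains absorbs the unbounded inputs after completing the square, so that
  \<open>W'\<close> is bounded above. This one-sided bound suffices for \<open>W \<longlongrightarrow> 0\<close>.
\<close>

subsection \<open>Absolutely continuous functions\<close>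

lemma abs_cont_deriv_integral:
  assumes "abs_cont_deriv x v" "0 \<le> s" "s \<le> t"
  shows "v absolutely_integrable_on {s..t}" "v integrable_on {s..t}"
    "x t - x s = integral {s..t} v"
proof -
  have t: "v absolutely_integrable_on {0..t}" "x t = x 0 + integral {0..t} v"
    and s: "x s = x 0 + integral {0..s} v"
    using assms unfolding abs_cont_deriv_def by (metis order_trans)+
  show *: "v absolutely_integrable_on {s..t}"
    using absolutely_integrable_on_subinterval[OF t(1), of s t] assms by auto
  then show "v integrable_on {s..t}"
    by (rule set_lebesgue_integral_eq_integral(1))
  have "integral {0..s} v + integral {s..t} v = integral {0..t} v"
    using assms(2,3) set_lebesgue_integral_eq_integral(1)[OF t(1)]
    by (rule Henstock_Kurzweil_Integration.integral_combine)
  then show "x t - x s = integral {s..t} v"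
    by (metis t(2) s add_diff_cancel_left add_diff_cancel_left')
qed

lemma abs_cont_deriv_continuous_on:
  assumes "abs_cont_deriv x v"
  shows "continuous_on {0..T} x"
proof (cases "0 \<le> T")
  case True
  have "continuous_on {0..T} (\<lambda>t. x 0 + integral {0..t} v)"
    using abs_cont_deriv_integral(2)[OF assms _ True]
    by (intro continuous_intros indefinite_integral_continuous_1) auto
  then show ?thesis
  proof (rule continuous_on_eq)
    fix t assume "t \<in> {0..T}"
    then show "x 0 + integral {0..t} v = x t"
      using abs_cont_deriv_integral(3)[OF assms, of 0 t] by (simp add: algebra_simps)
  qed
qed simp

lemma abs_cont_deriv_const: "abs_cont_deriv (\<lambda>t. c) (\<lambda>t. 0)"
  by (simp add: abs_cont_deriv_def)

lemma abs_cont_deriv_indefinite_integral: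
  fixes f :: "real \<Rightarrow> 'a::euclidean_space"
  assumes "\<And>T. continuous_on {0..T} f"
  shows "abs_cont_deriv (\<lambda>t. integral {0..t} f) f"
  using assms by (simp add: abs_cont_deriv_def absolutely_integrable_continuous_real)

lemma abs_cont_deriv_add:
  assumes "abs_cont_deriv x v" "abs_cont_deriv y w"
  shows "abs_cont_deriv (\<lambda>t. x t + y t) (\<lambda>t. v t + w t)"
  unfolding abs_cont_deriv_def
proof (intro allI impI conjI)
  fix T :: real assume T: "0 \<le> T"
  have *: "v absolutely_integrable_on {0..T}" "w absolutely_integrable_on {0..T}"
    "x T = x 0 + integral {0..T} v" "y T = y 0 + integral {0..T} w"
    using assms T unfolding abs_cont_deriv_def by blast+
  show "(\<lambda>t. v t + w t) absolutely_integrable_on {0..T}"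
    using *(1,2) by (rule set_integral_add)
  show "x T + y T = x 0 + y 0 + integral {0..T} (\<lambda>t. v t + w t)"
    using *(3,4) integral_add[OF *(1,2)[THEN set_lebesgue_integral_eq_integral(1)]] by simp
qed

lemma abs_cont_deriv_sum:
  assumes "\<And>i. i \<in> I \<Longrightarrow> abs_cont_deriv (x i) (v i)"
  shows "abs_cont_deriv (\<lambda>t. \<Sum>i\<in>I. x i t) (\<lambda>t. \<Sum>i\<in>I. v i t)"
  using assms
  by (induction I rule: infinite_finite_induct)
    (auto intro: abs_cont_deriv_add simp: abs_cont_deriv_const)

lemma abs_cont_deriv_bounded_linear:
  assumes "bounded_linear h" "abs_cont_deriv x v"
  shows "abs_cont_deriv (\<lambda>t. h (x t)) (\<lambda>t. h (v t))"
  unfolding abs_cont_deriv_def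
proof (intro allI impI conjI)
  fix T :: real assume T: "0 \<le> T"
  have *: "v absolutely_integrable_on {0..T}" "x T = x 0 + integral {0..T} v"
    using assms(2) T unfolding abs_cont_deriv_def by blast+
  show "(\<lambda>t. h (v t)) absolutely_integrable_on {0..T}"
    using absolutely_integrable_linear[OF *(1) assms(1)] by (simp add: o_def)
  show "h (x T) = h (x 0) + integral {0..T} (\<lambda>t. h (v t))"
    using integral_linear[OF set_lebesgue_integral_eq_integral(1)[OF *(1)] assms(1)]
    by (simp add: *(2) o_def bounded_linear.linear[OF assms(1), THEN linear_add])
qed

text \<open>A uniform subdivision with mesh below \<open>\<delta>\<close>: over its pieces the
  increments of \<open>G\<close> telescope, while those of \<open>F\<close> add up by the triangle
  inequality.\<close>

lemma increments_le_small_multiple: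
  fixes F :: "real \<Rightarrow> 'a::real_normed_vector" and G :: "real \<Rightarrow> real"
  assumes "0 < \<delta>" and "a \<le> b"
    and "\<And>s t. a \<le> s \<Longrightarrow> s \<le> t \<Longrightarrow> t \<le> b \<Longrightarrow> t - s < \<delta> \<Longrightarrow> norm (F t - F s) \<le> e * (G t - G s)"
  shows "norm (F b - F a) \<le> e * (G b - G a)"
proof -
  obtain N :: nat where N: "(b - a) / \<delta> < real N" "N > 0"
  proof -
    \<comment> \<open>The maximum with 0 forces \<open>N > 0\<close> also when \<open>a = b\<close>,
      so that the division by \<open>real N\<close> in \<open>p\<close> is genuine.\<close>
    obtain N :: nat where "max ((b - a) / \<delta>) 0 < real N"
      using reals_Archimedean2 by blast
    then show thesis using that[of N] by simp
  qed
  define p where "p k = a + (b - a) * real k / real N" for k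
  have "norm (F (p k) - F a) \<le> e * (G (p k) - G a)" if "k \<le> N" for k
    using that
  proof (induction k)
    case 0
    then show ?case by (simp add: p_def)
  next
    case (Suc k)
    have "p (Suc k) - p k = (b - a) / real N"
      by (simp add: p_def algebra_simps add_divide_distrib diff_divide_distrib)
    also have "\<dots> < \<delta>"
      using N \<open>0 < \<delta>\<close> by (simp add: field_simps)
    finally have d: "p (Suc k) - p k < \<delta>" .
    have le: "a \<le> p k" "p k \<le> p (Suc k)"
      using \<open>a \<le> b\<close> by (auto simp: p_def intro!: divide_right_mono mult_left_mono)
    have "(b - a) * real (Suc k) \<le> (b - a) * real N"
      using Suc.prems \<open>a \<le> b\<close> by (intro mult_left_mono) auto
    then have "p (Suc k) \<le> b"
      using N by (simp add: p_def field_simps)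
    with assms(3)[OF le _ d] have "norm (F (p (Suc k)) - F (p k)) \<le> e * (G (p (Suc k)) - G (p k))" by simp
    moreover have "norm (F (p (Suc k)) - F a) \<le> norm (F (p (Suc k)) - F (p k)) + norm (F (p k) - F a)"
      using norm_triangle_ineq[of "F (p (Suc k)) - F (p k)" "F (p k) - F a"] by simp
    ultimately show ?case using Suc by (simp add: algebra_simps)
  qed
  from this[of N] show ?thesis using N by (simp add: p_def)
qed

text \<open>
  The product rule is obtained without pointwise derivatives: by uniform continuity, the increments
  of the difference of both sides are at most an arbitrarily small multiple of those of
  \<open>\<integral> (\<bar>v\<bar> + \<bar>w\<bar>)\<close>.
\<close>

lemma abs_cont_deriv_inner:
  fixes x y :: "real \<Rightarrow> 'a::euclidean_space"
  assumes x: "abs_cont_deriv x v" and y: "abs_cont_deriv y w"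
  shows "abs_cont_deriv (\<lambda>t. x t \<bullet> y t) (\<lambda>t. v t \<bullet> y t + x t \<bullet> w t)"
  unfolding abs_cont_deriv_def
proof (intro allI impI conjI)
  fix T :: real assume T: "0 \<le> T"
  have cx: "continuous_on {0..T} x" and cy: "continuous_on {0..T} y"
    using x y by (blast intro: abs_cont_deriv_continuous_on)+
  have v: "v absolutely_integrable_on {0..T}" and w: "w absolutely_integrable_on {0..T}"
    using assms T unfolding abs_cont_deriv_def by blast+
  \<comment> \<open>On a compact interval a continuous factor is bounded and measurable, hence a
    multiplier of absolutely integrable functions.\<close>
  have prod: "(\<lambda>t. f t \<bullet> g t) absolutely_integrable_on {0..T}"
    if "continuous_on {0..T} f" "g absolutely_integrable_on {0..T}"
    for f g :: "real \<Rightarrow> 'a"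
  proof (rule absolutely_integrable_bounded_measurable_product[where h = "(\<bullet>)" and f = f])
    show "bilinear ((\<bullet>) :: 'a \<Rightarrow> 'a \<Rightarrow> real)"
      by (simp add: bilinear_conv_bounded_bilinear bounded_bilinear_inner)
    show "f \<in> borel_measurable (lebesgue_on {0..T})"
      using that(1) by (rule continuous_imp_measurable_on_sets_lebesgue) simp
    show "bounded (f ` {0..T})"
      using that(1) by (intro compact_imp_bounded compact_continuous_image) auto
  qed (use that in auto)
  have vy: "(\<lambda>t. v t \<bullet> y t) absolutely_integrable_on {0..T}"
    using prod[OF cy v] by (simp add: inner_commute)
  have xw: "(\<lambda>t. x t \<bullet> w t) absolutely_integrable_on {0..T}"
    by (rule prod[OF cx w])
  show abs: "(\<lambda>t. v t \<bullet> y t + x t \<bullet> w t) absolutely_integrable_on {0..T}"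
    using vy xw by (rule set_integral_add)
  define g where "g t = norm (v t) + norm (w t)" for t
  define G where "G t = integral {0..t} g" for t
  define F where "F t = x t \<bullet> y t - integral {0..t} (\<lambda>t. v t \<bullet> y t + x t \<bullet> w t)" for t
  have g: "g absolutely_integrable_on {0..T}"
    unfolding g_def using absolutely_integrable_norm[OF v] absolutely_integrable_norm[OF w]
    by (simp add: o_def set_integral_add)
  have bound: "norm (F T - F 0) \<le> e * (G T - G 0)" if "e > 0" for e
  proof -
    obtain d1 where d1: "d1 > 0"
      "\<And>s t. s \<in> {0..T} \<Longrightarrow> t \<in> {0..T} \<Longrightarrow> dist t s < d1 \<Longrightarrow> dist (x t) (x s) < e"
      using compact_uniformly_continuous[OF cx] \<open>e > 0\<close> by (auto simp: uniformly_continuous_on_def)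
    obtain d2 where d2: "d2 > 0"
      "\<And>s t. s \<in> {0..T} \<Longrightarrow> t \<in> {0..T} \<Longrightarrow> dist t s < d2 \<Longrightarrow> dist (y t) (y s) < e"
      using compact_uniformly_continuous[OF cy] \<open>e > 0\<close> by (auto simp: uniformly_continuous_on_def)
    show ?thesis
    proof (rule increments_le_small_multiple[of "min d1 d2"])
      fix s t assume st: "0 \<le> s" "s \<le> t" "t \<le> T" "t - s < min d1 d2"
      have sub: "f integrable_on {s..t}" "f integrable_on {0..t}" if "f absolutely_integrable_on {0..T}"
        for f :: "real \<Rightarrow> real"
        using absolutely_integrable_on_subinterval[OF that, of s t]
          absolutely_integrable_on_subinterval[OF that, of 0 t] st
        by (auto simp: absolutely_integrable_on_def)
      have comb: "integral {0..t} f - integral {0..s} f = integral {s..t} f"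
        if "f absolutely_integrable_on {0..T}" for f :: "real \<Rightarrow> real"
        using Henstock_Kurzweil_Integration.integral_combine[OF st(1,2) sub(2)[OF that]] by linarith
      note iv = abs_cont_deriv_integral[OF x st(1,2)] and iw = abs_cont_deriv_integral[OF y st(1,2)]
      have i1: "(\<lambda>\<tau>. v \<tau> \<bullet> y s) integrable_on {s..t}" and i2: "(\<lambda>\<tau>. x t \<bullet> w \<tau>) integrable_on {s..t}"
        using integrable_linear[OF iv(2) bounded_linear_inner_left[of "y s"]]
          integrable_linear[OF iw(2) bounded_linear_inner_right[of "x t"]]
        by (auto simp: o_def)
      \<comment> \<open>Freezing \<open>y\<close> at the left end and \<open>x\<close> at the right
        end makes this splitting exact; no second-order remainder is left to estimate.\<close>
      have "x t \<bullet> y t - x s \<bullet> y s = (x t - x s) \<bullet> y s + x t \<bullet> (y t - y s)"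
        by (simp add: inner_diff)
      also have "\<dots> = integral {s..t} (\<lambda>\<tau>. v \<tau> \<bullet> y s) + integral {s..t} (\<lambda>\<tau>. x t \<bullet> w \<tau>)"
        using integral_linear[OF iv(2) bounded_linear_inner_left[of "y s"]]
          integral_linear[OF iw(2) bounded_linear_inner_right[of "x t"]]
        by (simp add: o_def iv(3) iw(3))
      finally have "F t - F s = integral {s..t} (\<lambda>\<tau>. v \<tau> \<bullet> y s) + integral {s..t} (\<lambda>\<tau>. x t \<bullet> w \<tau>)
          - integral {s..t} (\<lambda>\<tau>. v \<tau> \<bullet> y \<tau> + x \<tau> \<bullet> w \<tau>)"
        using comb[OF abs] by (simp add: F_def)
      also have "integral {s..t} (\<lambda>\<tau>. v \<tau> \<bullet> y s) + integral {s..t} (\<lambda>\<tau>. x t \<bullet> w \<tau>)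
          - integral {s..t} (\<lambda>\<tau>. v \<tau> \<bullet> y \<tau> + x \<tau> \<bullet> w \<tau>)
        = integral {s..t} (\<lambda>\<tau>. (v \<tau> \<bullet> y s + x t \<bullet> w \<tau>) - (v \<tau> \<bullet> y \<tau> + x \<tau> \<bullet> w \<tau>))"
        using i1 i2 sub[OF abs] sub[OF vy] sub[OF xw] by (simp add: integral_add integral_diff integrable_add)
      also have "norm \<dots> \<le> integral {s..t} (\<lambda>\<tau>. e * g \<tau>)"
      proof (rule integral_norm_bound_integral)
        show "(\<lambda>\<tau>. (v \<tau> \<bullet> y s + x t \<bullet> w \<tau>) - (v \<tau> \<bullet> y \<tau> + x \<tau> \<bullet> w \<tau>)) integrable_on {s..t}"
          by (intro integrable_diff integrable_add i1 i2 sub(1)[OF abs])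
        show "(\<lambda>\<tau>. e * g \<tau>) integrable_on {s..t}"
          using sub(1)[OF g] by (rule integrable_on_mult_right)
        fix \<tau> assume \<tau>: "\<tau> \<in> {s..t}"
        have 1: "norm (y s - y \<tau>) \<le> e"
          using d2(2)[of s \<tau>] \<tau> st by (auto simp: dist_norm norm_minus_commute)
        have 2: "norm (x t - x \<tau>) \<le> e"
          using d1(2)[of \<tau> t] \<tau> st by (auto simp: dist_norm)
        have "(v \<tau> \<bullet> y s + x t \<bullet> w \<tau>) - (v \<tau> \<bullet> y \<tau> + x \<tau> \<bullet> w \<tau>) = v \<tau> \<bullet> (y s - y \<tau>) + (x t - x \<tau>) \<bullet> w \<tau>"
          by (simp add: inner_diff)
        also have "norm \<dots> \<le> norm (v \<tau>) * norm (y s - y \<tau>) + norm (x t - x \<tau>) * norm (w \<tau>)"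
          by (intro norm_triangle_le add_mono) (auto intro: Cauchy_Schwarz_ineq2)
        also have "\<dots> \<le> norm (v \<tau>) * e + e * norm (w \<tau>)"
          using 1 2 by (intro add_mono mult_left_mono mult_right_mono) auto
        finally show "norm ((v \<tau> \<bullet> y s + x t \<bullet> w \<tau>) - (v \<tau> \<bullet> y \<tau> + x \<tau> \<bullet> w \<tau>)) \<le> e * g \<tau>"
          by (simp add: g_def algebra_simps)
      qed
      also have "\<dots> = e * (G t - G s)"
        by (simp add: G_def comb[OF g])
      finally show "norm (F t - F s) \<le> e * (G t - G s)" .
    qed (use d1 d2 T in auto)
  qed
  have "norm (F T - F 0) \<le> 0"
  proof (rule field_le_epsilon)
    fix e :: real assume "e > 0"
    \<comment> \<open>The summand 1 keeps the denominator positive when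
      \<open>G T = G 0\<close>.\<close>
    define q where "q = e / (\<bar>G T - G 0\<bar> + 1)"
    have "q > 0" using \<open>e > 0\<close> by (simp add: q_def)
    then have "norm (F T - F 0) \<le> q * (G T - G 0)" by (rule bound)
    also have "\<dots> \<le> q * (\<bar>G T - G 0\<bar> + 1)"
      using \<open>q > 0\<close> by (intro mult_left_mono) auto
    also have "\<dots> = e"
      by (simp add: q_def add_pos_nonneg field_simps)
    finally show "norm (F T - F 0) \<le> 0 + e" by simp
  qed
  then show "x T \<bullet> y T = x 0 \<bullet> y 0 + integral {0..T} (\<lambda>t. v t \<bullet> y t + x t \<bullet> w t)"
    by (simp add: F_def)
qed

section \<open>Monotonicity from the sign of the derivative, and a one-sided Barbalat lemma\<close>

lemma abs_cont_deriv_nonpos_imp_antimono: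
  fixes f :: "real \<Rightarrow> real"
  assumes f: "abs_cont_deriv f g" and ae: "AE t in lebesgue. 0 \<le> t \<longrightarrow> g t \<le> 0"
    and st: "0 \<le> s" "s \<le> t"
  shows "f t \<le> f s"
proof -
  obtain N where N: "negligible N" "{t. \<not> (0 \<le> t \<longrightarrow> g t \<le> 0)} \<subseteq> N"
    using ae by (auto simp: eventually_ae_filter_negligible)
  note i = abs_cont_deriv_integral[OF f st]
  \<comment> \<open>The integral comparison below is pointwise on the whole interval, so
    \<open>g\<close> is replaced by a function that is nonpositive everywhere and agrees with it off
    a null set.\<close>
  have min: "min (g \<tau>) 0 = g \<tau>" if "\<tau> \<in> {s..t} - N" for \<tau>
  proof -
    have "0 \<le> \<tau>" using that st by auto
    then have "g \<tau> \<le> 0" using that N(2) by blast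
    then show ?thesis by simp
  qed
  have "integral {s..t} g = integral {s..t} (\<lambda>\<tau>. min (g \<tau>) 0)"
    using min by (rule integral_spike[OF N(1)])
  moreover have "(\<lambda>\<tau>. min (g \<tau>) 0) integrable_on {s..t}"
    using min by (rule integrable_spike[OF i(2) N(1)])
  then have "integral {s..t} (\<lambda>\<tau>. min (g \<tau>) 0) \<le> integral {s..t} (\<lambda>\<tau>. 0)"
    by (intro integral_le) auto
  ultimately show ?thesis using i(3) by simp
qed

text \<open>Since \<open>W\<close> cannot rise quickly, a large value at \<open>t\<close> forces
  large values on an interval just before \<open>t\<close>, which adds a fixed amount to the
  integral. The integral is nondecreasing and bounded, so its late increments are too small for
  that. Rapid falls of \<open>W\<close> do no harm.\<close>

lemma barbalat_one_sided:
  fixes W :: "real \<Rightarrow> real"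
  assumes cont: "\<And>T. continuous_on {0..T} W" and nonneg: "\<And>t. 0 \<le> t \<Longrightarrow> 0 \<le> W t"
    and growth: "\<And>s t. 0 \<le> s \<Longrightarrow> s \<le> t \<Longrightarrow> W t \<le> W s + C * (t - s)"
    and bound: "\<And>T. 0 \<le> T \<Longrightarrow> integral {0..T} W \<le> B"
  shows "(W \<longlongrightarrow> 0) at_top"
proof -
  define G where "G t = integral {0..t} W" for t
  define L where "L = (SUP t\<in>{0..}. G t)"
  have bdd: "bdd_above (G ` {0..})"
    using bound by (auto simp: G_def bdd_above_def)
  have int: "W integrable_on {s..t}" if "0 \<le> s" for s t
    using that by (intro integrable_continuous_interval continuous_on_subset[OF cont[of t]]) auto
  have inc: "G t - G s = integral {s..t} W" if "0 \<le> s" "s \<le> t" for s t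
    using Henstock_Kurzweil_Integration.integral_combine[OF that int] by (simp add: G_def)
  have GL: "G t \<le> L" if "0 \<le> t" for t
    unfolding L_def using that bdd by (intro cSUP_upper) auto
  show ?thesis
  proof (rule tendstoI)
    fix e :: real assume "e > 0"
    \<comment> \<open>The window is so short that \<open>W\<close> rises by less than
      \<open>e / 2\<close> across it.\<close>
    define h where "h = e / (2 * (\<bar>C\<bar> + 1))"
    have h: "h > 0" using \<open>e > 0\<close> by (simp add: h_def)
    have "(\<bar>C\<bar> + 1) * h = e / 2" by (simp add: h_def add_nonneg_eq_0_iff field_simps)
    then have Ch: "\<bar>C\<bar> * h < e / 2" using h by (simp add: algebra_simps)
    have "L - h * (e / 2) < L" using h \<open>e > 0\<close> by simp
    \<comment> \<open>After \<open>t0\<close> the integral can grow by less than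
      \<open>h * (e / 2)\<close>, so a window of length \<open>h\<close> cannot hold values of
      \<open>W\<close> that are all at least \<open>e / 2\<close>.\<close>
    then obtain t0 where t0: "t0 \<ge> 0" "L - h * (e / 2) < G t0"
      unfolding L_def using less_cSUP_iff[OF _ bdd, of "(SUP t\<in>{0..}. G t) - h * (e / 2)"]
      by (metis atLeast_iff empty_iff order_refl)
    have "dist (W t) 0 < e" if t: "t \<ge> t0 + h" for t
    proof -
      have "h * (W t - \<bar>C\<bar> * h) = integral {t - h..t} (\<lambda>\<tau>. W t - \<bar>C\<bar> * h)"
        using h by simp
      also have "\<dots> \<le> integral {t - h..t} W"
      proof (intro integral_le int)
        fix \<tau> assume "\<tau> \<in> {t - h..t}"
        then have "W t \<le> W \<tau> + C * (t - \<tau>)" "C * (t - \<tau>) \<le> \<bar>C\<bar> * h"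
          using t t0 by (auto intro!: growth mult_mono)
        then show "W t - \<bar>C\<bar> * h \<le> W \<tau>" by simp
      qed (use t t0 h in auto)
      also have "\<dots> = G t - G (t - h)"
        using t t0 h by (intro inc[symmetric]) auto
      also have "G t0 \<le> G (t - h)"
        using inc[of t0 "t - h"] t t0 h nonneg integral_nonneg[OF int, of t0 "t - h"] by fastforce
      then have "G t - G (t - h) < h * (e / 2)"
        using GL[of t] t t0 h by linarith
      finally have "W t < e" using h Ch by simp
      then show ?thesis using nonneg[of t] t t0 h by simp
    qed
    then show "\<forall>\<^sub>F t in at_top. dist (W t) 0 < e"
      by (auto simp: eventually_at_top_linorder)
  qed
qed

text \<open>The constant is the minimum of the quadratic form on the compact unit sphere;
  homogeneity of degree 2 extends the bound to all vectors.\<close>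

lemma pos_def_lower_bound:
  fixes Q :: "'n::finite rmat"
  assumes "pos_def Q"
  obtains c where "c > 0" "\<And>x. c * (norm x)\<^sup>2 \<le> x \<bullet> (Q *v x)"
proof -
  let ?S = "sphere (0 :: 'n rvec) 1"
  have "continuous_on ?S (\<lambda>x. x \<bullet> (Q *v x))"
    by (intro continuous_intros linear_continuous_on matrix_vector_mul_bounded_linear)
  moreover have "axis undefined 1 \<in> ?S" by (simp add: norm_axis_1)
  ultimately obtain p where p: "p \<in> ?S" "\<And>x. x \<in> ?S \<Longrightarrow> p \<bullet> (Q *v p) \<le> x \<bullet> (Q *v x)"
    using continuous_attains_inf[OF compact_sphere] by blast
  have pos: "p \<bullet> (Q *v p) > 0" proof -
    have "p \<noteq> 0" using p(1) by auto
    then show ?thesis using assms by (simp add: pos_def_def)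
  qed
  have "(p \<bullet> (Q *v p)) * (norm x)\<^sup>2 \<le> x \<bullet> (Q *v x)" for x
  proof (cases "x = 0")
    case False
    have "p \<bullet> (Q *v p) \<le> (x /\<^sub>R norm x) \<bullet> (Q *v (x /\<^sub>R norm x))"
      using False by (intro p(2)) simp
    then show ?thesis
      using False by (simp add: matrix_vector_mult_scaleR field_simps power2_eq_square)
  qed simp
  with pos that show thesis by blast
qed

lemma abs_cont_deriv_norm_diff_square:
  fixes x :: "real \<Rightarrow> 'a::euclidean_space"
  assumes "abs_cont_deriv x v"
  shows "abs_cont_deriv (\<lambda>t. c * (norm (x t - p))\<^sup>2) (\<lambda>t. c * (2 * ((x t - p) \<bullet> v t)))"
proof -
  have "abs_cont_deriv (\<lambda>t. x t - p) v"
    using abs_cont_deriv_add[OF assms abs_cont_deriv_const[of "- p"]] by simp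
  from abs_cont_deriv_bounded_linear[OF bounded_linear_mult_right abs_cont_deriv_inner[OF this this], of c]
  show ?thesis by (simp add: power2_norm_eq_inner inner_commute[of "v _"])
qed

subsection \<open>Gain matching and error dynamics\<close>

text \<open>Companion matrices differ in the last row only, so every mismatch between plant and
  reference acts along the input direction, where feedback can cancel it.\<close>

lemma companion_form_diff_mult_vec:
  fixes A A' :: "'n::{finite,linorder} rmat"
  assumes "companion_form A" "companion_form A'"
  shows "A *v x - A' *v x = ((A $ Max UNIV - A' $ Max UNIV) \<bullet> x) *\<^sub>R e_last"
proof -
  have "A $ i = A' $ i" if "i \<noteq> Max UNIV" for i
    using that assms by (simp add: companion_form_def vec_eq_iff)
  then have "(A *v x) $ i - (A' *v x) $ i = (if i = Max UNIV then (A $ i - A' $ i) \<bullet> x else 0)" for i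
    by (auto simp: matrix_vector_mult_def inner_vec_def sum_subtractf left_diff_distrib)
  then show ?thesis
    by (simp add: vec_eq_iff e_last_def axis_def)
qed

text \<open>Averaging over pure modes turns the indicator of a mode into its weight. Mode 0 carries
  no switched gain: for \<open>i = 0\<close> all indicators in the inner sum vanish.\<close>

lemma sum_shift_delta:
  fixes g :: "nat \<Rightarrow> 'a::real_vector"
  shows "(\<Sum>i<m. c i *\<^sub>R (\<Sum>j\<in>{1..<m}. (if j = i then 1 else 0) *\<^sub>R g j)) = (\<Sum>j\<in>{1..<m}. c j *\<^sub>R g j)"
proof -
  have "(\<Sum>i<m. c i *\<^sub>R (\<Sum>j\<in>{1..<m}. (if j = i then 1 else 0) *\<^sub>R g j))
    = (\<Sum>i<m. if i \<in> {1..<m} then c i *\<^sub>R g i else 0)"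
    by (intro sum.cong refl) (simp add: if_distrib[of "\<lambda>c. c *\<^sub>R _"] cong: if_cong)
  also have "\<dots> = (\<Sum>i\<in>{..<m} \<inter> {1..<m}. c i *\<^sub>R g i)"
    by (rule sum.inter_restrict[symmetric]) simp
  also have "{..<m} \<inter> {1..<m} = {1..<m}" by auto
  finally show ?thesis .
qed

text \<open>This is the integral part of the feedback gain. Arbitrary real weights \<open>s\<close>
  and \<open>sh\<close> let one expression serve both pure modes and Filippov averages; the
  proportional part stays outside because it acts as damping rather than being matched.\<close>

definition feedback_gain ::
    "nat \<Rightarrow> nat \<Rightarrow> (nat \<Rightarrow> real) \<Rightarrow> (nat \<Rightarrow> real) \<Rightarrow> 'n::finite cl_state \<Rightarrow> 'n rvec" where
  "feedback_gain m mh s sh z =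
     k0 z + (\<Sum>j\<in>{1..<m}. s j *\<^sub>R kP z j) + (\<Sum>k\<in>{1..<mh}. sh k *\<^sub>R kM z k)"

definition affine_gain ::
    "nat \<Rightarrow> nat \<Rightarrow> (nat \<Rightarrow> real) \<Rightarrow> (nat \<Rightarrow> real) \<Rightarrow> 'n::finite cl_state \<Rightarrow> real" where
  "affine_gain m mh s sh z =
     k0A z + (\<Sum>j\<in>{1..<m}. s j * kPA z j) + (\<Sum>k\<in>{1..<mh}. sh k * kMA z k)"

text \<open>
  With these gains the plant in mode \<open>i\<close> coincides with the reference in mode \<open>k\<close>: mode \<open>0\<close> is
  matched by the unswitched gains, and \<open>kP\<close>, \<open>kM\<close> hold the differences to mode \<open>0\<close>. Only their
  entries with index at least \<open>1\<close> are used.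
\<close>

definition matching_gains ::
    "'n::{finite,linorder} pwa \<Rightarrow> 'n pwa \<Rightarrow> 'n cl_state" where
  "matching_gains S R =
     (let b = ingain S; a = (\<lambda>i. sysmat S i $ Max UNIV); ah = (\<lambda>k. sysmat R k $ Max UNIV)
      in \<lparr> err = 0,
           kR = ingain R / b,
           k0 = (1 / b) *\<^sub>R (ah 0 - a 0),
           k0A = (offset R 0 - offset S 0) / b,
           kP = (\<lambda>j. (1 / b) *\<^sub>R (a 0 - a j)),
           kPA = (\<lambda>j. (offset S 0 - offset S j) / b),
           kM = (\<lambda>k. (1 / b) *\<^sub>R (ah k - ah 0)),
           kMA = (\<lambda>k. (offset R k - offset R 0) / b) \<rparr>)"

section \<open>Averages of the control law over the plant modes\<close>

lemma control_eq:
  "control m mh P \<beta> s sh w x z =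
     (kR z + \<beta> * out_err P (err z) * w) * w
     + (feedback_gain m mh s sh z + (\<beta> * out_err P (err z)) *\<^sub>R x) \<bullet> x + affine_gain m mh s sh z"
  by (simp add: control_def feedback_gain_def affine_gain_def Let_def algebra_simps)

lemma convex_sum_feedback_gain:
  assumes "(\<Sum>i<m. \<gamma> i) = (1::real)"
  shows "(\<Sum>i<m. \<gamma> i *\<^sub>R feedback_gain m mh (\<lambda>j. if j = i then 1 else 0) sh z) = feedback_gain m mh \<gamma> sh z"
  using assms
  by (simp add: feedback_gain_def scaleR_add_right sum.distrib sum_shift_delta del: One_nat_def flip: scaleR_sum_left)

lemma convex_sum_affine_gain:
  assumes "(\<Sum>i<m. \<gamma> i) = (1::real)"
  shows "(\<Sum>i<m. \<gamma> i * affine_gain m mh (\<lambda>j. if j = i then 1 else 0) sh z) = affine_gain m mh \<gamma> sh z"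
  using assms sum_shift_delta[of \<gamma> "kPA z" m]
  by (simp add: affine_gain_def distrib_left sum.distrib flip: sum_distrib_right)

text \<open>The control is affine in the plant indicators, and total weight 1 preserves the
  unswitched terms. Hence a Filippov average of controls is the control evaluated at the averaged
  indicators.\<close>

lemma convex_sum_control:
  assumes "(\<Sum>i<m. \<gamma> i) = (1::real)"
  shows "(\<Sum>i<m. \<gamma> i * control m mh P \<beta> (\<lambda>j. if j = i then 1 else 0) sh w x z)
    = control m mh P \<beta> \<gamma> sh w x z"
proof -
  define c where "c = (kR z + \<beta> * out_err P (err z) * w) * w"
  define d where "d = (\<beta> * out_err P (err z)) *\<^sub>R x \<bullet> x"
  have "(\<Sum>i<m. \<gamma> i * control m mh P \<beta> (\<lambda>j. if j = i then 1 else 0) sh w x z)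
    = (\<Sum>i<m. \<gamma> i) * (c + d)
      + (\<Sum>i<m. \<gamma> i *\<^sub>R feedback_gain m mh (\<lambda>j. if j = i then 1 else 0) sh z) \<bullet> x
      + (\<Sum>i<m. \<gamma> i * affine_gain m mh (\<lambda>j. if j = i then 1 else 0) sh z)"
    unfolding sum_distrib_right inner_sum_left sum.distrib[symmetric]
    by (intro sum.cong refl) (simp add: control_eq c_def d_def inner_add_left distrib_left)
  also have "\<dots> = control m mh P \<beta> \<gamma> sh w x z"
    unfolding convex_sum_feedback_gain[OF assms] convex_sum_affine_gain[OF assms] assms
    by (simp add: control_eq c_def d_def inner_add_left)
  finally show ?thesis .
qed

section \<open>Matching gains at averaged modes\<close>

lemma sum_lessThan_atLeast1:
  fixes f :: "nat \<Rightarrow> 'a::comm_monoid_add"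
  assumes "0 < m" shows "(\<Sum>i<m. f i) = f 0 + (\<Sum>i\<in>{1..<m}. f i)"
  using assms by (simp add: sum.atLeast_Suc_lessThan lessThan_atLeast0)

text \<open>The weight of mode 0 is one minus the others. Thus a base value plus switched deviations
  from it, as stored in the matching gains, reproduces the full weighted average.\<close>

lemma sum_switched:
  fixes f :: "nat \<Rightarrow> 'a::real_vector"
  assumes "(\<Sum>i<m. \<gamma> i) = (1::real)"
  shows "f 0 + (\<Sum>i\<in>{1..<m}. \<gamma> i *\<^sub>R (f i - f 0)) = (\<Sum>i<m. \<gamma> i *\<^sub>R f i)"
proof -
  \<comment> \<open>An empty sum would be 0, so total weight 1 forces mode 0 to exist.\<close>
  have m: "0 < m" using assms by (cases m) auto
  have "\<gamma> 0 = 1 - (\<Sum>i\<in>{1..<m}. \<gamma> i)"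
    using assms sum_lessThan_atLeast1[OF m, of \<gamma>] by simp
  then show ?thesis
    by (simp add: sum_lessThan_atLeast1[OF m, of "\<lambda>i. \<gamma> i *\<^sub>R f i"] scaleR_diff_right sum_subtractf
        scaleR_diff_left flip: scaleR_sum_left)
qed

text \<open>The mode 0 entries in \<open>k0\<close>, \<open>kP\<close> and \<open>kM\<close>
  recombine through \<open>sum_switched\<close>, used once with the plant weights and once with the
  reference weights. The same constant gains therefore match every average of modes, sliding
  included.\<close>

lemma matching_gains_feedback:
  fixes S R :: "'n::{finite,linorder} pwa"
  assumes "ingain S > 0" "(\<Sum>i<m. \<gamma> i) = 1" "(\<Sum>k<mh. sh k) = 1"
  shows "ingain S *\<^sub>R feedback_gain m mh \<gamma> sh (matching_gains S R) =
    (\<Sum>k<mh. sh k *\<^sub>R (sysmat R k $ Max UNIV)) - (\<Sum>i<m. \<gamma> i *\<^sub>R (sysmat S i $ Max UNIV))"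
proof -
  let ?a = "\<lambda>i. sysmat S i $ Max UNIV" and ?ah = "\<lambda>i. sysmat R i $ Max UNIV"
  have "ingain S *\<^sub>R feedback_gain m mh \<gamma> sh (matching_gains S R) =
    (?ah 0 + (\<Sum>k\<in>{1..<mh}. sh k *\<^sub>R (?ah k - ?ah 0)))
    - (?a 0 + (\<Sum>i\<in>{1..<m}. \<gamma> i *\<^sub>R (?a i - ?a 0)))"
    using assms(1)
    by (simp add: feedback_gain_def matching_gains_def Let_def scaleR_add_right scaleR_sum_right
        scaleR_diff_right sum_subtractf mult.commute)
  then show ?thesis
    using sum_switched[OF assms(2), of ?a] sum_switched[OF assms(3), of ?ah] by simp
qed

lemma matching_gains_affine:
  fixes S R :: "'n::{finite,linorder} pwa"
  assumes "ingain S > 0" "(\<Sum>i<m. \<gamma> i) = 1" "(\<Sum>k<mh. sh k) = 1"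
  shows "ingain S * affine_gain m mh \<gamma> sh (matching_gains S R) =
    (\<Sum>k<mh. sh k * offset R k) - (\<Sum>i<m. \<gamma> i * offset S i)"
proof -
  have "ingain S * affine_gain m mh \<gamma> sh (matching_gains S R) =
    (offset R 0 + (\<Sum>k\<in>{1..<mh}. sh k * (offset R k - offset R 0)))
    - (offset S 0 + (\<Sum>i\<in>{1..<m}. \<gamma> i * (offset S i - offset S 0)))"
    using assms(1)
    by (simp add: affine_gain_def matching_gains_def Let_def distrib_left sum_distrib_left
        right_diff_distrib diff_divide_distrib sum_subtractf)
  then show ?thesis
    using sum_switched[OF assms(2), of "offset S"] sum_switched[OF assms(3), of "offset R"] by simp
qed

lemma region_indicator:
  assumes "pwa_system R" "K < modes R" "xh \<in> region R K" "k < modes R"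
  shows "xh \<in> region R k \<longleftrightarrow> k = K"
  using assms by (auto simp: pwa_system_def domain_partition_def)

text \<open>Splitting \<open>xh\<close> into error plus plant state gives each mode the common term
  \<open>sysmat R K *v err z\<close> and a mismatch along \<open>e_last\<close>. The mismatch is
  linear in the weights, so its average is the input that the matching gains would produce, and only
  deviations from these gains and the proportional damping remain.\<close>

lemma err_cl_field:
  fixes S R :: "'n::{finite,linorder} pwa" and z :: "'n cl_state" and P :: "'n rmat" and xh :: "'n rvec"
  assumes S: "pwa_system S" and R: "pwa_system R" and K: "K < modes R" "xh \<in> region R K"
    and \<gamma>: "(\<Sum>i<modes S. \<gamma> i) = 1"
  defines "x \<equiv> xh - err z" and "y \<equiv> out_err P (err z)"
    and "sh \<equiv> \<lambda>k. if xh \<in> region R k then 1 else (0::real)" and "q \<equiv> matching_gains S R"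
    and "m \<equiv> modes S" and "mh \<equiv> modes R"
  shows "(\<Sum>i<modes S. \<gamma> i *\<^sub>R err (cl_field S R P \<alpha> \<beta> \<rho> w xh i z)) =
    sysmat R K *v err z - (ingain S *
      ((kR z - kR q) * w + (feedback_gain m mh \<gamma> sh z - feedback_gain m mh \<gamma> sh q) \<bullet> x
       + (affine_gain m mh \<gamma> sh z - affine_gain m mh \<gamma> sh q) + \<beta> * y * (w\<^sup>2 + (norm x)\<^sup>2))) *\<^sub>R e_last"
proof -
  let ?a = "\<lambda>i. sysmat S i $ Max UNIV" and ?ah = "\<lambda>i. sysmat R i $ Max UNIV"
  define u where "u i = control m mh P \<beta> (\<lambda>j. if j = i then 1 else 0) sh w x z" for i
  have b: "ingain S > 0" using S by (simp add: pwa_system_def)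
  have sh: "sh k = (if k = K then 1 else 0)" if "k < mh" for k
    using region_indicator[OF R K] that by (simp add: sh_def mh_def)
  \<comment> \<open>Disjointness of the regions makes \<open>sh\<close> the unit weight on the
    active reference mode \<open>K\<close>.\<close>
  have pick: "(\<Sum>k<mh. sh k *\<^sub>R f k) = f K" for f :: "nat \<Rightarrow> 'b::real_vector"
  proof -
    have "(\<Sum>k<mh. sh k *\<^sub>R f k) = (\<Sum>k<mh. if k = K then f k else 0)"
      using sh by (intro sum.cong) auto
    then show ?thesis using K by (simp add: mh_def)
  qed
  have sh1: "(\<Sum>k<mh. sh k) = 1" using pick[of "\<lambda>_. 1::real"] by simp
  have \<gamma>': "(\<Sum>i<m. \<gamma> i) = 1" using \<gamma> by (simp add: m_def)
  have err: "err (cl_field S R P \<alpha> \<beta> \<rho> w xh i z) = pwa_field R K xh w - pwa_field S i x (u i)" for i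
    using pick[of "\<lambda>k. pwa_field R k xh w"]
    by (simp add: cl_field_def Let_def u_def x_def sh_def m_def mh_def)
  have diff: "err (cl_field S R P \<alpha> \<beta> \<rho> w xh i z) = sysmat R K *v err z
      + ((?ah K - ?a i) \<bullet> x + ingain R * w + offset R K - offset S i - ingain S * u i) *\<^sub>R e_last"
    if "i < m" for i
  proof -
    have "companion_form (sysmat R K)" "companion_form (sysmat S i)"
      using S R K that by (auto simp: pwa_system_def m_def)
    from companion_form_diff_mult_vec[OF this, of x]
    have "sysmat R K *v x = sysmat S i *v x + ((?ah K - ?a i) \<bullet> x) *\<^sub>R e_last"
      by (simp add: algebra_simps)
    moreover have "sysmat R K *v xh = sysmat R K *v err z + sysmat R K *v x"
      by (simp add: x_def matrix_vector_mult_diff_distrib)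
    ultimately show ?thesis
      unfolding err by (simp add: pwa_field_def algebra_simps)
  qed
  have "(\<Sum>i<m. \<gamma> i *\<^sub>R err (cl_field S R P \<alpha> \<beta> \<rho> w xh i z)) =
    (\<Sum>i<m. \<gamma> i *\<^sub>R (sysmat R K *v err z))
      + (\<Sum>i<m. (\<gamma> i * ((?ah K - ?a i) \<bullet> x + ingain R * w + offset R K - offset S i - ingain S * u i)) *\<^sub>R e_last)"
    unfolding sum.distrib[symmetric]
    by (intro sum.cong refl) (simp add: diff scaleR_add_right)
  also have "\<dots> = sysmat R K *v err z +
      (\<Sum>i<m. \<gamma> i * ((?ah K - ?a i) \<bullet> x + ingain R * w + offset R K - offset S i - ingain S * u i)) *\<^sub>R e_last"
    using \<gamma>' by (simp flip: scaleR_sum_left)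
  also have "(\<Sum>i<m. \<gamma> i * ((?ah K - ?a i) \<bullet> x + ingain R * w + offset R K - offset S i - ingain S * u i))
    = (\<Sum>i<m. \<gamma> i) * (?ah K \<bullet> x + ingain R * w + offset R K) - (\<Sum>i<m. \<gamma> i *\<^sub>R ?a i) \<bullet> x
      - (\<Sum>i<m. \<gamma> i * offset S i) - ingain S * (\<Sum>i<m. \<gamma> i * u i)"
    unfolding sum_distrib_right sum_distrib_left inner_sum_left sum_subtractf[symmetric]
    by (intro sum.cong refl) (simp add: algebra_simps)
  also have "\<dots> = (?ah K - (\<Sum>i<m. \<gamma> i *\<^sub>R ?a i)) \<bullet> x + ingain R * w
      + (offset R K - (\<Sum>i<m. \<gamma> i * offset S i)) - ingain S * control m mh P \<beta> \<gamma> sh w x z"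
    unfolding u_def convex_sum_control[OF \<gamma>'] \<gamma>' by (simp add: inner_diff_left)
  also have "?ah K - (\<Sum>i<m. \<gamma> i *\<^sub>R ?a i) = ingain S *\<^sub>R feedback_gain m mh \<gamma> sh q"
    unfolding q_def matching_gains_feedback[OF b \<gamma>' sh1] pick ..
  also have "offset R K - (\<Sum>i<m. \<gamma> i * offset S i) = ingain S * affine_gain m mh \<gamma> sh q"
    using pick[of "offset R"] by (simp add: q_def matching_gains_affine[OF b \<gamma>' sh1])
  also have "ingain R * w = ingain S * (kR q * w)"
    using b by (simp add: q_def matching_gains_def Let_def)
  also have "(ingain S *\<^sub>R feedback_gain m mh \<gamma> sh q) \<bullet> x + ingain S * (kR q * w)
      + ingain S * affine_gain m mh \<gamma> sh q - ingain S * control m mh P \<beta> \<gamma> sh w x z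
    = - (ingain S * ((kR z - kR q) * w + (feedback_gain m mh \<gamma> sh z - feedback_gain m mh \<gamma> sh q) \<bullet> x
       + (affine_gain m mh \<gamma> sh z - affine_gain m mh \<gamma> sh q) + \<beta> * y * (w\<^sup>2 + (norm x)\<^sup>2)))"
    by (simp add: control_eq y_def power2_eq_square algebra_simps flip: dot_square_norm[unfolded power2_eq_square])
  finally show ?thesis by (simp add: m_def)
qed

subsection \<open>Energy of the gain deviations\<close>

lemma feedback_gain_diff:
  "feedback_gain m mh s sh z - feedback_gain m mh s sh q =
     (k0 z - k0 q) + (\<Sum>j\<in>{1..<m}. s j *\<^sub>R (kP z j - kP q j)) + (\<Sum>k\<in>{1..<mh}. sh k *\<^sub>R (kM z k - kM q k))"
  by (simp add: feedback_gain_def scaleR_diff_right sum_subtractf)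

lemma affine_gain_diff:
  "affine_gain m mh s sh z - affine_gain m mh s sh q =
     (k0A z - k0A q) + (\<Sum>j\<in>{1..<m}. s j * (kPA z j - kPA q j)) + (\<Sum>k\<in>{1..<mh}. sh k * (kMA z k - kMA q k))"
  by (simp add: affine_gain_def right_diff_distrib sum_subtractf)

text \<open>The weight \<open>c\<close> belongs to the gains adapting at rate \<alpha>,
  \<open>d\<close> to those adapting at rate \<rho>. Writing the scalar terms with norms too lets
  one differentiation rule cover all summands.\<close>

definition gain_energy ::
    "nat \<Rightarrow> nat \<Rightarrow> real \<Rightarrow> real \<Rightarrow> 'n::finite cl_state \<Rightarrow> 'n cl_state \<Rightarrow> real" where
  "gain_energy m mh c d q z =
     c * (norm (kR z - kR q))\<^sup>2 + c * (norm (k0 z - k0 q))\<^sup>2 + d * (norm (k0A z - k0A q))\<^sup>2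
     + (\<Sum>j\<in>{1..<m}. d * (norm (kP z j - kP q j))\<^sup>2 + d * (norm (kPA z j - kPA q j))\<^sup>2)
     + (\<Sum>k\<in>{1..<mh}. d * (norm (kM z k - kM q k))\<^sup>2 + d * (norm (kMA z k - kMA q k))\<^sup>2)"

lemma gain_energy_nonneg: "0 \<le> c \<Longrightarrow> 0 \<le> d \<Longrightarrow> 0 \<le> gain_energy m mh c d q z"
  unfolding gain_energy_def by (intro add_nonneg_nonneg sum_nonneg mult_nonneg_nonneg) auto

text \<open>Every summand of the energy is nonnegative, hence at most \<open>V\<close>, which bounds
  each stored deviation by a common radius; the triangle inequality handles the weighted sums. The
  bound is chosen before the state and the weights, so it is uniform in time.\<close>

lemma gain_energy_bounds_gains:
  assumes "0 < c" "0 < d"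
  obtains B where "0 \<le> B"
    "\<And>z s sh. gain_energy m mh c d q z \<le> V \<Longrightarrow> (\<And>j. j \<in> {1..<m} \<Longrightarrow> \<bar>s j\<bar> \<le> 1) \<Longrightarrow>
        (\<And>k. k \<in> {1..<mh} \<Longrightarrow> \<bar>sh k\<bar> \<le> 1) \<Longrightarrow>
        \<bar>kR z - kR q\<bar> \<le> B \<and> norm (feedback_gain m mh s sh z - feedback_gain m mh s sh q) \<le> B \<and>
        \<bar>affine_gain m mh s sh z - affine_gain m mh s sh q\<bar> \<le> B"
proof -
  define e where "e = min c d"
  \<comment> \<open>The absolute value makes the radius well behaved before anything is known about
    the sign of \<open>V\<close>.\<close>
  define r where "r = sqrt (\<bar>V\<bar> / e)"
  have e: "e > 0" using assms by (simp add: e_def)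
  have r: "0 \<le> r" using e by (simp add: r_def)
  define B where "B = (1 + real m + real mh) * r"
  show thesis
  proof (rule that[of B])
    show "0 \<le> B" using r by (simp add: B_def)
    fix z and s sh :: "nat \<Rightarrow> real"
    assume V: "gain_energy m mh c d q z \<le> V" and s: "\<And>j. j \<in> {1..<m} \<Longrightarrow> \<bar>s j\<bar> \<le> 1"
      and sh: "\<And>k. k \<in> {1..<mh} \<Longrightarrow> \<bar>sh k\<bar> \<le> 1"
    define T1 where "T1 = c * (norm (kR z - kR q))\<^sup>2"
    define T2 where "T2 = c * (norm (k0 z - k0 q))\<^sup>2"
    define T3 where "T3 = d * (norm (k0A z - k0A q))\<^sup>2"
    define p where "p j = d * (norm (kP z j - kP q j))\<^sup>2 + d * (norm (kPA z j - kPA q j))\<^sup>2" for j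
    define h where "h k = d * (norm (kM z k - kM q k))\<^sup>2 + d * (norm (kMA z k - kMA q k))\<^sup>2" for k
    have nn: "0 \<le> T1" "0 \<le> T2" "0 \<le> T3" "\<And>j. 0 \<le> p j" "\<And>k. 0 \<le> h k"
      using assms by (auto simp: T1_def T2_def T3_def p_def h_def)
    have tot: "T1 + T2 + T3 + sum p {1..<m} + sum h {1..<mh} \<le> V"
      using V by (simp add: gain_energy_def T1_def T2_def T3_def p_def h_def)
    have nns: "0 \<le> sum p {1..<m}" "0 \<le> sum h {1..<mh}"
      using nn by (auto intro: sum_nonneg)
    have key: "norm a \<le> r" if "d' * (norm a)\<^sup>2 \<le> V" "e \<le> d'" for d' and a :: "'b::real_normed_vector"
    proof -
      have "e * (norm a)\<^sup>2 \<le> d' * (norm a)\<^sup>2" using that by (intro mult_right_mono) auto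
      then have "(norm a)\<^sup>2 \<le> \<bar>V\<bar> / e" using that e by (simp add: field_simps)
      then show ?thesis unfolding r_def by (rule real_le_rsqrt)
    qed
    have ed: "e \<le> c" "e \<le> d" by (auto simp: e_def)
    have R: "\<bar>kR z - kR q\<bar> \<le> r" and k0: "norm (k0 z - k0 q) \<le> r" and k0A: "\<bar>k0A z - k0A q\<bar> \<le> r"
      using key[of c "kR z - kR q"] key[of c "k0 z - k0 q"] key[of d "k0A z - k0A q"] ed tot nn nns
      by (auto simp: T1_def T2_def T3_def)
    have P: "norm (kP z j - kP q j) \<le> r \<and> \<bar>kPA z j - kPA q j\<bar> \<le> r" if "j \<in> {1..<m}" for j
    proof -
      have "p j \<le> sum p {1..<m}" using that nn by (intro member_le_sum) auto
      then have "p j \<le> V" using tot nn nns by linarith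
      then have "d * (norm (kP z j - kP q j))\<^sup>2 \<le> V" "d * (norm (kPA z j - kPA q j))\<^sup>2 \<le> V"
        using assms(2) unfolding p_def
        by (smt (verit) mult_nonneg_nonneg zero_le_power2)+
      then show ?thesis using key ed by (metis real_norm_def)
    qed
    have M: "norm (kM z j - kM q j) \<le> r \<and> \<bar>kMA z j - kMA q j\<bar> \<le> r" if "j \<in> {1..<mh}" for j
    proof -
      have "h j \<le> sum h {1..<mh}" using that nn by (intro member_le_sum) auto
      then have "h j \<le> V" using tot nn nns by linarith
      then have "d * (norm (kM z j - kM q j))\<^sup>2 \<le> V" "d * (norm (kMA z j - kMA q j))\<^sup>2 \<le> V"
        using assms(2) unfolding h_def
        by (smt (verit) mult_nonneg_nonneg zero_le_power2)+
      then show ?thesis using key ed by (metis real_norm_def)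
    qed
    have sum: "norm (\<Sum>j\<in>{1..<N}. u j *\<^sub>R a j) \<le> real N * r"
      if "\<And>j. j \<in> {1..<N} \<Longrightarrow> \<bar>u j\<bar> \<le> 1" "\<And>j. j \<in> {1..<N} \<Longrightarrow> norm (a j) \<le> r"
      for N u and a :: "nat \<Rightarrow> 'b::real_normed_vector"
    proof -
      have "norm (\<Sum>j\<in>{1..<N}. u j *\<^sub>R a j) \<le> (\<Sum>j\<in>{1..<N}. r)"
      proof (rule sum_norm_le)
        fix j assume j: "j \<in> {1..<N}"
        have "\<bar>u j\<bar> * norm (a j) \<le> 1 * r" using that[OF j] by (intro mult_mono) auto
        then show "norm (u j *\<^sub>R a j) \<le> r" by simp
      qed
      also have "\<dots> \<le> real N * r" using r by (simp add: mult_right_mono)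
      finally show ?thesis .
    qed
    have sum_real: "norm (\<Sum>j\<in>{1..<N}. u j * a j) \<le> real N * r"
      if "\<And>j. j \<in> {1..<N} \<Longrightarrow> \<bar>u j\<bar> \<le> 1" "\<And>j. j \<in> {1..<N} \<Longrightarrow> \<bar>a j\<bar> \<le> r" for N u a
      using sum[of N u a] that by simp
    have "norm (feedback_gain m mh s sh z - feedback_gain m mh s sh q) \<le> r + real m * r + real mh * r"
      unfolding feedback_gain_diff
      by (intro norm_triangle_le add_mono k0 sum) (use P M s sh in auto)
    moreover have "norm (affine_gain m mh s sh z - affine_gain m mh s sh q) \<le> r + real m * r + real mh * r"
      unfolding affine_gain_diff
      by (intro norm_triangle_le add_mono sum_real) (use P M s sh k0A in auto)
    moreover have "\<bar>kR z - kR q\<bar> \<le> B"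
    proof (rule order_trans[OF R])
      show "r \<le> B" using r by (simp add: B_def algebra_simps)
    qed
    ultimately show "\<bar>kR z - kR q\<bar> \<le> B \<and> norm (feedback_gain m mh s sh z - feedback_gain m mh s sh q) \<le> B \<and>
        \<bar>affine_gain m mh s sh z - affine_gain m mh s sh q\<bar> \<le> B"
      by (simp add: B_def algebra_simps)
  qed
qed

text \<open>Here \<open>\<phi>\<close> is the input error caused by the gain deviations. The point
  is that one and the same \<open>\<phi>\<close> drives the tracking error and the gain energy: the
  weights \<open>b / \<alpha>\<close> and \<open>b / \<rho>\<close> cancel the adaptation rates and
  leave the common factor \<open>b\<close>.\<close>

lemma closed_loop_energy_rates:
  fixes S R :: "'n::{finite,linorder} pwa" and z :: "real \<Rightarrow> 'n cl_state"
    and P :: "'n rmat" and xh :: "real \<Rightarrow> 'n rvec"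
  assumes S: "pwa_system S" and R: "pwa_system R" and pos: "0 < \<alpha>" "0 < \<rho>"
    and region: "AE t in lebesgue. 0 \<le> t \<longrightarrow> (\<exists>k<modes R. xh t \<in> region R k)"
    and z: "closed_loop_solution S R P \<alpha> \<beta> \<rho> r xh z"
  defines "q \<equiv> matching_gains S R" and "m \<equiv> modes S" and "mh \<equiv> modes R" and "b \<equiv> ingain S"
  obtains v D where
    "abs_cont_deriv (\<lambda>t. err (z t)) v"
    "abs_cont_deriv (\<lambda>t. gain_energy m mh (b / \<alpha>) (b / \<rho>) q (z t)) D"
    "AE t in lebesgue. 0 \<le> t \<longrightarrow> (\<exists>K<mh. \<exists>s sh \<phi>. (\<forall>j<m. 0 \<le> s j \<and> s j \<le> 1) \<and> (\<forall>k. 0 \<le> sh k \<and> sh k \<le> 1) \<and>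
       \<phi> = (kR (z t) - kR q) * r t
         + (feedback_gain m mh s sh (z t) - feedback_gain m mh s sh q) \<bullet> (xh t - err (z t))
         + (affine_gain m mh s sh (z t) - affine_gain m mh s sh q) \<and>
       v t = sysmat R K *v err (z t) - (b * (\<phi> + \<beta> * out_err P (err (z t)) * ((r t)\<^sup>2 + (norm (xh t - err (z t)))\<^sup>2))) *\<^sub>R e_last \<and>
       D t = 2 * b * out_err P (err (z t)) * \<phi>)"
proof -
  define f where "f t i = cl_field S R P \<alpha> \<beta> \<rho> (r t) (xh t) i (z t)" for t i
  obtain \<gamma> where \<gamma>: "AE t in lebesgue. 0 \<le> t \<longrightarrow> filippov_weights S (xh t - err (z t)) (\<gamma> t)"
    and derr: "abs_cont_deriv (\<lambda>t. err (z t)) (\<lambda>t. \<Sum>i<m. \<gamma> t i *\<^sub>R err (f t i))"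
    and dR: "abs_cont_deriv (\<lambda>t. kR (z t)) (\<lambda>t. \<Sum>i<m. \<gamma> t i * kR (f t i))"
    and d0: "abs_cont_deriv (\<lambda>t. k0 (z t)) (\<lambda>t. \<Sum>i<m. \<gamma> t i *\<^sub>R k0 (f t i))"
    and d0A: "abs_cont_deriv (\<lambda>t. k0A (z t)) (\<lambda>t. \<Sum>i<m. \<gamma> t i * k0A (f t i))"
    and dP: "\<And>j. j \<in> {1..<m} \<Longrightarrow> abs_cont_deriv (\<lambda>t. kP (z t) j) (\<lambda>t. \<Sum>i<m. \<gamma> t i *\<^sub>R kP (f t i) j)"
    and dPA: "\<And>j. j \<in> {1..<m} \<Longrightarrow> abs_cont_deriv (\<lambda>t. kPA (z t) j) (\<lambda>t. \<Sum>i<m. \<gamma> t i * kPA (f t i) j)"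
    and dM: "\<And>k. k \<in> {1..<mh} \<Longrightarrow> abs_cont_deriv (\<lambda>t. kM (z t) k) (\<lambda>t. \<Sum>i<m. \<gamma> t i *\<^sub>R kM (f t i) k)"
    and dMA: "\<And>k. k \<in> {1..<mh} \<Longrightarrow> abs_cont_deriv (\<lambda>t. kMA (z t) k) (\<lambda>t. \<Sum>i<m. \<gamma> t i * kMA (f t i) k)"
    using z unfolding closed_loop_solution_def Let_def f_def m_def mh_def by blast
  let ?c = "b / \<alpha>" and ?d = "b / \<rho>"
  define D where "D t =
      ?c * (2 * ((kR (z t) - kR q) \<bullet> (\<Sum>i<m. \<gamma> t i * kR (f t i))))
    + ?c * (2 * ((k0 (z t) - k0 q) \<bullet> (\<Sum>i<m. \<gamma> t i *\<^sub>R k0 (f t i))))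
    + ?d * (2 * ((k0A (z t) - k0A q) \<bullet> (\<Sum>i<m. \<gamma> t i * k0A (f t i))))
    + (\<Sum>j\<in>{1..<m}. ?d * (2 * ((kP (z t) j - kP q j) \<bullet> (\<Sum>i<m. \<gamma> t i *\<^sub>R kP (f t i) j)))
        + ?d * (2 * ((kPA (z t) j - kPA q j) \<bullet> (\<Sum>i<m. \<gamma> t i * kPA (f t i) j))))
    + (\<Sum>k\<in>{1..<mh}. ?d * (2 * ((kM (z t) k - kM q k) \<bullet> (\<Sum>i<m. \<gamma> t i *\<^sub>R kM (f t i) k)))
        + ?d * (2 * ((kMA (z t) k - kMA q k) \<bullet> (\<Sum>i<m. \<gamma> t i * kMA (f t i) k))))" for t
  have dE: "abs_cont_deriv (\<lambda>t. gain_energy m mh ?c ?d q (z t)) D"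
    unfolding gain_energy_def D_def
    by (intro abs_cont_deriv_add abs_cont_deriv_sum abs_cont_deriv_norm_diff_square dR d0 d0A dP dPA dM dMA)
  show thesis
  proof (rule that[OF derr dE])
    show "AE t in lebesgue. 0 \<le> t \<longrightarrow> (\<exists>K<mh. \<exists>s sh \<phi>. (\<forall>j<m. 0 \<le> s j \<and> s j \<le> 1) \<and> (\<forall>k. 0 \<le> sh k \<and> sh k \<le> 1) \<and>
       \<phi> = (kR (z t) - kR q) * r t
         + (feedback_gain m mh s sh (z t) - feedback_gain m mh s sh q) \<bullet> (xh t - err (z t))
         + (affine_gain m mh s sh (z t) - affine_gain m mh s sh q) \<and>
       (\<Sum>i<m. \<gamma> t i *\<^sub>R err (f t i)) = sysmat R K *v err (z t) - (b * (\<phi> + \<beta> * out_err P (err (z t)) * ((r t)\<^sup>2 + (norm (xh t - err (z t)))\<^sup>2))) *\<^sub>R e_last \<and>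
       D t = 2 * b * out_err P (err (z t)) * \<phi>)"
      using \<gamma> region
    proof eventually_elim
      case (elim t)
      show ?case
      proof
        assume "0 \<le> t"
        then obtain K where K: "K < mh" "xh t \<in> region R K"
          and w: "filippov_weights S (xh t - err (z t)) (\<gamma> t)"
          using elim by (auto simp: mh_def)
        define x where "x = xh t - err (z t)"
        define y where "y = out_err P (err (z t))"
        \<comment> \<open>The Filippov weights themselves are the averaged plant indicators, both in
          the control and in the adaptation laws; this makes the two occurrences of
          \<open>\<phi>\<close> agree during sliding.\<close>
        define s where "s = \<gamma> t"
        define sh where "sh k = (if xh t \<in> region R k then 1 else (0::real))" for k
        define \<phi> where "\<phi> = (kR (z t) - kR q) * r t
         + (feedback_gain m mh s sh (z t) - feedback_gain m mh s sh q) \<bullet> x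
         + (affine_gain m mh s sh (z t) - affine_gain m mh s sh q)"
        have s1: "(\<Sum>i<m. s i) = 1" and s0: "\<And>i. i < m \<Longrightarrow> 0 \<le> s i"
          using w by (auto simp: filippov_weights_def s_def m_def)
        have sle: "s i \<le> 1" if "i < m" for i
          using member_le_sum[of i "{..<m}" s] s0 s1 that by auto
        have err: "(\<Sum>i<m. s i *\<^sub>R err (f t i)) = sysmat R K *v err (z t)
            - (b * (\<phi> + \<beta> * y * ((r t)\<^sup>2 + (norm x)\<^sup>2))) *\<^sub>R e_last"
          using err_cl_field[OF S R K(1)[unfolded mh_def] K(2) s1[unfolded m_def]]
          unfolding f_def \<phi>_def x_def y_def sh_def[abs_def] q_def m_def mh_def b_def by simp
        have cR: "(\<Sum>i<m. s i * kR (f t i)) = \<alpha> * y * r t"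
          and c0A: "(\<Sum>i<m. s i * k0A (f t i)) = \<rho> * y"
          and cMA: "(\<Sum>i<m. s i * kMA (f t i) k) = \<rho> * y * sh k" for k
          using s1 by (auto simp: f_def cl_field_def Let_def y_def sh_def simp flip: sum_distrib_right)
        have c0: "(\<Sum>i<m. s i *\<^sub>R k0 (f t i)) = (\<alpha> * y) *\<^sub>R x"
          and cM: "(\<Sum>i<m. s i *\<^sub>R kM (f t i) k) = (\<rho> * y * sh k) *\<^sub>R x" for k
          using s1 by (auto simp: f_def cl_field_def Let_def y_def x_def sh_def simp flip: scaleR_sum_left sum_distrib_right)
        have sel: "(\<Sum>i<m. s i * (a * (if j = i then 1 else 0))) = a * s j" if "j < m" for a :: real and j
          using that by (simp add: if_distrib[of "(*) _"] mult.commute cong: if_cong)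
        have cPA: "(\<Sum>i<m. s i * kPA (f t i) j) = \<rho> * y * s j" if "j \<in> {1..<m}" for j
          using sel[of j "\<rho> * y"] that by (simp add: f_def cl_field_def Let_def y_def)
        have cP: "(\<Sum>i<m. s i *\<^sub>R kP (f t i) j) = (\<rho> * y * s j) *\<^sub>R x" if "j \<in> {1..<m}" for j
        proof -
          have "(\<Sum>i<m. s i *\<^sub>R kP (f t i) j) = (\<Sum>i<m. s i * (\<rho> * y * (if j = i then 1 else 0))) *\<^sub>R x"
            unfolding scaleR_sum_left by (intro sum.cong) (auto simp: f_def cl_field_def Let_def y_def x_def)
          then show ?thesis using sel[of j "\<rho> * y"] that by simp
        qed
        have sums: "(\<Sum>j\<in>{1..<m}. ?d * (2 * ((kP (z t) j - kP q j) \<bullet> (\<Sum>i<m. s i *\<^sub>R kP (f t i) j)))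
            + ?d * (2 * ((kPA (z t) j - kPA q j) \<bullet> (\<Sum>i<m. s i * kPA (f t i) j))))
          = 2 * b * y * ((\<Sum>j\<in>{1..<m}. s j *\<^sub>R (kP (z t) j - kP q j)) \<bullet> x + (\<Sum>j\<in>{1..<m}. s j * (kPA (z t) j - kPA q j)))"
          unfolding inner_sum_left sum.distrib[symmetric] sum_distrib_left
          using pos by (intro sum.cong refl) (simp only: cP cPA, simp add: field_simps inner_diff_left)
        have sumsh: "(\<Sum>k\<in>{1..<mh}. ?d * (2 * ((kM (z t) k - kM q k) \<bullet> (\<Sum>i<m. s i *\<^sub>R kM (f t i) k)))
            + ?d * (2 * ((kMA (z t) k - kMA q k) \<bullet> (\<Sum>i<m. s i * kMA (f t i) k))))
          = 2 * b * y * ((\<Sum>k\<in>{1..<mh}. sh k *\<^sub>R (kM (z t) k - kM q k)) \<bullet> x + (\<Sum>k\<in>{1..<mh}. sh k * (kMA (z t) k - kMA q k)))"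
          unfolding inner_sum_left sum.distrib[symmetric] sum_distrib_left
          using pos by (intro sum.cong refl) (simp only: cM cMA, simp add: field_simps inner_diff_left)
        have "D t = 2 * b * y * ((kR (z t) - kR q) * r t) + 2 * b * y * ((k0 (z t) - k0 q) \<bullet> x) + 2 * b * y * (k0A (z t) - k0A q)
            + 2 * b * y * ((\<Sum>j\<in>{1..<m}. s j *\<^sub>R (kP (z t) j - kP q j)) \<bullet> x + (\<Sum>j\<in>{1..<m}. s j * (kPA (z t) j - kPA q j)))
            + 2 * b * y * ((\<Sum>k\<in>{1..<mh}. sh k *\<^sub>R (kM (z t) k - kM q k)) \<bullet> x + (\<Sum>k\<in>{1..<mh}. sh k * (kMA (z t) k - kMA q k)))"
          unfolding D_def s_def[symmetric] sums sumsh cR c0 c0A using pos by (simp add: field_simps)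
        also have "\<dots> = 2 * b * y * \<phi>"
          unfolding \<phi>_def feedback_gain_diff affine_gain_diff by (simp add: inner_add_left distrib_left)
        finally have D: "D t = 2 * b * y * \<phi>" .
        have bounds: "\<forall>j<m. 0 \<le> s j \<and> s j \<le> 1" "\<forall>k. 0 \<le> sh k \<and> sh k \<le> 1"
          using s0 sle by (auto simp: sh_def)
        show "\<exists>K<mh. \<exists>s sh \<phi>. (\<forall>j<m. 0 \<le> s j \<and> s j \<le> 1) \<and> (\<forall>k. 0 \<le> sh k \<and> sh k \<le> 1) \<and>
           \<phi> = (kR (z t) - kR q) * r t
             + (feedback_gain m mh s sh (z t) - feedback_gain m mh s sh q) \<bullet> (xh t - err (z t))
             + (affine_gain m mh s sh (z t) - affine_gain m mh s sh q) \<and>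
           (\<Sum>i<m. \<gamma> t i *\<^sub>R err (f t i)) = sysmat R K *v err (z t) - (b * (\<phi> + \<beta> * out_err P (err (z t)) * ((r t)\<^sup>2 + (norm (xh t - err (z t)))\<^sup>2))) *\<^sub>R e_last \<and>
           D t = 2 * b * out_err P (err (z t)) * \<phi>"
          unfolding x_def[symmetric] y_def[symmetric] s_def[symmetric]
          using K(1) bounds \<phi>_def err D by blast
      qed
    qed
  qed
qed

subsection \<open>Convergence of the tracking error\<close>

text \<open>The bound is the maximum of the left side over \<open>p\<close>, attained at
  \<open>p = - g / (2 * \<beta>)\<close>.\<close>

lemma quadratic_upper_bound:
  fixes p g \<beta> :: real
  assumes "0 < \<beta>"
  shows "- (p * g) - \<beta> * p\<^sup>2 \<le> g\<^sup>2 / (4 * \<beta>)"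
proof -
  have "0 \<le> (2 * \<beta> * p + g)\<^sup>2" by simp
  then have "4 * \<beta> * (- (p * g) - \<beta> * p\<^sup>2) \<le> g\<^sup>2" by (simp add: power2_eq_square algebra_simps)
  then show ?thesis using assms by (simp add: pos_le_divide_eq mult.commute)
qed

text \<open>The products with \<open>w\<close> and \<open>x\<close>, which may be unbounded, are
  each absorbed by their own square, of \<open>y * w\<close> or of \<open>y *\<^sub>R x\<close>, at
  a cost of \<open>B\<^sup>2 / (4 * \<beta>)\<close>. Only the term with \<open>h\<close> uses the
  bound on \<open>y\<close>.\<close>

lemma input_bound:
  fixes x f :: "'a::real_inner" and y w \<kappa> g h \<beta> B Y :: real
  assumes "0 < \<beta>" "\<bar>\<kappa>\<bar> \<le> B" "norm f \<le> B" "\<bar>h\<bar> \<le> B" "\<bar>y\<bar> \<le> Y"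
  shows "- (y * (\<kappa> * w + f \<bullet> x + h + \<beta> * y * (w\<^sup>2 + (norm x)\<^sup>2))) \<le> B\<^sup>2 / (2 * \<beta>) + Y * B"
proof -
  have B: "0 \<le> B" using assms(2) by simp
  have "- (y * w * \<kappa>) - \<beta> * (y * w)\<^sup>2 \<le> \<kappa>\<^sup>2 / (4 * \<beta>)"
    using assms(1) by (rule quadratic_upper_bound)
  also have "\<dots> \<le> B\<^sup>2 / (4 * \<beta>)"
    using assms(1,2) B by (intro divide_right_mono) (auto simp: abs_le_square_iff[symmetric])
  finally have 1: "- (y * w * \<kappa>) - \<beta> * (y * w)\<^sup>2 \<le> B\<^sup>2 / (4 * \<beta>)" .
  have "\<bar>f \<bullet> (y *\<^sub>R x)\<bar> \<le> norm f * norm (y *\<^sub>R x)" by (rule Cauchy_Schwarz_ineq2)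
  also have "\<dots> \<le> B * norm (y *\<^sub>R x)" using assms(3) by (intro mult_right_mono) auto
  finally have "- (f \<bullet> (y *\<^sub>R x)) \<le> norm (y *\<^sub>R x) * B" by (simp add: mult.commute)
  \<comment> \<open>With \<open>g = - B\<close> the linear term becomes the worst case allowed by
    Cauchy-Schwarz.\<close>
  with quadratic_upper_bound[OF assms(1), of "norm (y *\<^sub>R x)" "- B"]
  have 2: "- (f \<bullet> (y *\<^sub>R x)) - \<beta> * (norm (y *\<^sub>R x))\<^sup>2 \<le> B\<^sup>2 / (4 * \<beta>)" by simp
  have "\<bar>y * h\<bar> \<le> Y * B" unfolding abs_mult using assms(4,5) by (intro mult_mono) auto
  then have 3: "- (y * h) \<le> Y * B" by simp
  have "- (y * (\<kappa> * w + f \<bullet> x + h + \<beta> * y * (w\<^sup>2 + (norm x)\<^sup>2))) =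
    (- (y * w * \<kappa>) - \<beta> * (y * w)\<^sup>2) + (- (f \<bullet> (y *\<^sub>R x)) - \<beta> * (norm (y *\<^sub>R x))\<^sup>2) - y * h"
    by (simp add: power_mult_distrib power2_eq_square algebra_simps)
  with 1 2 3 show ?thesis by simp
qed

section \<open>Quadratic forms in the Lyapunov inequalities\<close>

lemma inner_symmetric_matrix:
  fixes P :: "'n::finite rmat"
  assumes "transpose P = P"
  shows "x \<bullet> (P *v y) = (P *v x) \<bullet> y"
  by (metis assms dot_lmul_matrix transpose_matrix_vector)

lemma lyapunov_form:
  fixes P A :: "'n::finite rmat"
  assumes "transpose P = P"
  shows "x \<bullet> ((P ** A + transpose A ** P) *v x) = 2 * ((P *v x) \<bullet> (A *v x))"
proof -
  have "x \<bullet> ((P ** A) *v x) = (P *v x) \<bullet> (A *v x)"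
    by (simp add: inner_symmetric_matrix[OF assms] flip: matrix_vector_mul_assoc)
  moreover have "x \<bullet> ((transpose A ** P) *v x) = (P *v x) \<bullet> (A *v x)"
    by (metis dot_lmul_matrix inner_commute matrix_vector_mul_assoc transpose_matrix_vector)
  ultimately show ?thesis by (simp add: matrix_vector_mult_add_rdistrib inner_add_right)
qed

lemma neg_def_common_decay:
  fixes Q :: "nat \<Rightarrow> 'n::finite rmat"
  assumes "\<forall>k<N. neg_def (Q k)"
  obtains c where "0 < c" "\<And>k x. k < N \<Longrightarrow> x \<bullet> (Q k *v x) \<le> - c * (norm x)\<^sup>2"
proof -
  have "\<forall>k\<in>{..<N}. \<exists>c>0. \<forall>x. x \<bullet> (Q k *v x) \<le> - c * (norm x)\<^sup>2"
  proof
    fix k assume "k \<in> {..<N}"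
    then obtain c where c: "c > 0" "\<And>x. c * (norm x)\<^sup>2 \<le> x \<bullet> (- Q k *v x)"
      using assms pos_def_lower_bound[of "- Q k"] unfolding neg_def_def by blast
    have "- Q k *v x = - (Q k *v x)" for x
      by (simp add: matrix_vector_mult_def vec_eq_iff sum_negf)
    then have "x \<bullet> (Q k *v x) \<le> - c * (norm x)\<^sup>2" for x
      using c(2)[of x] by simp
    with c(1) show "\<exists>c>0. \<forall>x. x \<bullet> (Q k *v x) \<le> - c * (norm x)\<^sup>2" by blast
  qed
  then obtain c where c: "\<And>k. k < N \<Longrightarrow> c k > (0::real)"
    "\<And>k x. k < N \<Longrightarrow> x \<bullet> (Q k *v x) \<le> - c k * (norm x)\<^sup>2"
    by (metis lessThan_iff)
  \<comment> \<open>Inserting 1 keeps the minimum over a nonempty set when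
    \<open>N = 0\<close>.\<close>
  define d where "d = Min (insert 1 (c ` {..<N}))"
  have "d > 0" using c(1) by (auto simp: d_def)
  moreover have "x \<bullet> (Q k *v x) \<le> - d * (norm x)\<^sup>2" if "k < N" for k x
  proof -
    have "d \<le> c k" using that by (auto simp: d_def)
    then have "d * (norm x)\<^sup>2 \<le> c k * (norm x)\<^sup>2" by (intro mult_right_mono) auto
    then show ?thesis using c(2)[OF that, of x] by simp
  qed
  ultimately show thesis using that by blast
qed

theorem theorem1:
  fixes S R :: "'n::{finite,linorder} pwa"
    and P :: "'n rmat"
    and \<alpha> \<beta> \<rho> :: real
    and r :: "real \<Rightarrow> real"
    and xh0 :: "'n rvec"
    and xh :: "real \<Rightarrow> 'n rvec"
    and z :: "real \<Rightarrow> 'n cl_state"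
  assumes plant: "pwa_system S"
    and reference: "pwa_system R"
    and well_posed: "well_posed R r xh0"
    and no_sliding: "no_sliding R r xh0"
    and P: "pos_def P"
    and lyapunov: "\<forall>k<modes R. neg_def (P ** sysmat R k + transpose (sysmat R k) ** P)"
    and gains: "0 < \<alpha>" "0 < \<beta>" "0 < \<rho>"
    and xh: "pwa_solution R r xh" "xh 0 = xh0"
    and z: "closed_loop_solution S R P \<alpha> \<beta> \<rho> r xh z"
  shows "((\<lambda>t. err (z t)) \<longlongrightarrow> 0) at_top"
proof -
  define b where "b = ingain S"
  define m where "m = modes S"
  define mh where "mh = modes R"
  define q where "q = matching_gains S R"
  define E where "E t = err (z t)" for t
  define U where "U t = gain_energy m mh (b / \<alpha>) (b / \<rho>) q (z t)" for t
  define W where "W t = E t \<bullet> (P *v E t)" for t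
  have b: "0 < b" using plant by (simp add: pwa_system_def b_def)
  have sym: "transpose P = P" using P by (simp add: pos_def_def)
  \<comment> \<open>Almost always the reference lies inside a region, so its indicators select
    exactly one mode.\<close>
  have region: "AE t in lebesgue. 0 \<le> t \<longrightarrow> (\<exists>k<modes R. xh t \<in> region R k)"
    using no_sliding xh by (simp add: no_sliding_def)
  define good where "good t s sh \<phi> \<longleftrightarrow> (\<forall>j<m. 0 \<le> s j \<and> s j \<le> 1) \<and> (\<forall>k. 0 \<le> sh k \<and> sh k \<le> 1) \<and>
       \<phi> = (kR (z t) - kR q) * r t
         + (feedback_gain m mh s sh (z t) - feedback_gain m mh s sh q) \<bullet> (xh t - E t)
         + (affine_gain m mh s sh (z t) - affine_gain m mh s sh q)" for t s sh \<phi>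
  \<comment> \<open>The contribution of the proportional gains to the input; multiplied by
    \<open>out_err P (E t)\<close> it is nonnegative.\<close>
  define dis where "dis t = \<beta> * out_err P (E t) * ((r t)\<^sup>2 + (norm (xh t - E t))\<^sup>2)" for t
  obtain v D where v: "abs_cont_deriv E v" and D: "abs_cont_deriv U D"
    and rates: "AE t in lebesgue. 0 \<le> t \<longrightarrow> (\<exists>K<mh. \<exists>s sh \<phi>. good t s sh \<phi> \<and>
       v t = sysmat R K *v E t - (b * (\<phi> + dis t)) *\<^sub>R e_last \<and> D t = 2 * b * out_err P (E t) * \<phi>)"
    by (rule closed_loop_energy_rates[OF plant reference gains(1,3) region z])
      (auto simp: E_def[abs_def] U_def[abs_def] good_def dis_def b_def m_def mh_def q_def conj_assoc)
  have Pv: "abs_cont_deriv (\<lambda>t. P *v E t) (\<lambda>t. P *v v t)"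
    using matrix_vector_mul_bounded_linear v by (rule abs_cont_deriv_bounded_linear)
  define w where "w t = v t \<bullet> (P *v E t) + E t \<bullet> (P *v v t)" for t
  have w: "abs_cont_deriv W w"
    unfolding W_def[abs_def] w_def[abs_def] by (rule abs_cont_deriv_inner[OF v Pv])
  \<comment> \<open>Symmetry of \<open>P\<close> pairs \<open>e_last\<close> with
    \<open>P *v E t\<close>, which is exactly the output error used in the adaptation laws.\<close>
  have w_eq: "w t = 2 * ((P *v E t) \<bullet> (A *v E t)) - 2 * b * out_err P (E t) * (\<phi> + dis t)"
    if "v t = A *v E t - (b * (\<phi> + dis t)) *\<^sub>R e_last" for t A \<phi>
  proof -
    have "w t = 2 * ((P *v E t) \<bullet> v t)"
      by (simp add: w_def inner_symmetric_matrix[OF sym, of "E t"] inner_commute[of "v t"])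
    then show ?thesis
      by (simp add: that inner_diff_right out_err_def inner_commute[of e_last])
  qed

  obtain c where c: "0 < c" "\<And>k x. k < mh \<Longrightarrow> 2 * ((P *v x) \<bullet> (sysmat R k *v x)) \<le> - c * (norm x)\<^sup>2"
    using neg_def_common_decay[OF lyapunov] unfolding lyapunov_form[OF sym] mh_def by blast
  obtain p where p: "0 < p" "\<And>x. p * (norm x)\<^sup>2 \<le> x \<bullet> (P *v x)"
    using pos_def_lower_bound[OF P] by blast
  obtain N where N: "0 < N" "\<And>x. norm (P *v x) \<le> norm x * N"
    using bounded_linear.pos_bounded[OF matrix_vector_mul_bounded_linear[of P]] by blast
  have WN: "W t \<le> N * (norm (E t))\<^sup>2" for t
  proof -
    have "W t \<le> norm (E t) * norm (P *v E t)" unfolding W_def by (rule norm_cauchy_schwarz)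
    also have "\<dots> \<le> norm (E t) * (norm (E t) * N)" using N by (intro mult_left_mono) auto
    finally show ?thesis by (simp add: power2_eq_square ac_simps)
  qed
  have Wp: "p * (norm (E t))\<^sup>2 \<le> W t" for t unfolding W_def by (rule p(2))
  have W0: "0 \<le> W t" for t
    using Wp[of t] p(1) by (smt (verit) mult_nonneg_nonneg zero_le_power2)
  have U0: "0 \<le> U t" for t
    unfolding U_def using b gains by (intro gain_energy_nonneg) auto

  \<comment> \<open>Chosen so that \<open>a * W t\<close> is at most the decay
    \<open>c * (norm (E t))\<^sup>2\<close>.\<close>
  define a where "a = c / N"
  have a: "a > 0" using c(1) N(1) by (simp add: a_def)
  have contW: "continuous_on {0..T} W" for T using w by (rule abs_cont_deriv_continuous_on)
  \<comment> \<open>Adding the integral of \<open>a * W\<close> turns decay into plain monotonicity,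
    which gives the bounds on \<open>W\<close> and \<open>U\<close> and the integrability of
    \<open>W\<close> at once.\<close>
  have "abs_cont_deriv (\<lambda>t. integral {0..t} (\<lambda>t. a * W t)) (\<lambda>t. a * W t)"
    by (intro abs_cont_deriv_indefinite_integral continuous_intros contW)
  from abs_cont_deriv_add[OF abs_cont_deriv_add[OF w D] this]
  have V: "abs_cont_deriv (\<lambda>t. W t + U t + integral {0..t} (\<lambda>t. a * W t)) (\<lambda>t. w t + D t + a * W t)" .
  have "AE t in lebesgue. 0 \<le> t \<longrightarrow> w t + D t + a * W t \<le> 0"
    using rates
  proof eventually_elim
    case (elim t)
    show ?case
    proof
      assume "0 \<le> t"
      then obtain K \<phi> where K: "K < mh" and v: "v t = sysmat R K *v E t - (b * (\<phi> + dis t)) *\<^sub>R e_last"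
        and D: "D t = 2 * b * out_err P (E t) * \<phi>" using elim by blast
      \<comment> \<open>The terms in \<open>\<phi>\<close> cancel between the tracking error and the
        gain energy.\<close>
      have "w t + D t = 2 * ((P *v E t) \<bullet> (sysmat R K *v E t)) - 2 * b * (out_err P (E t) * dis t)"
        unfolding w_eq[OF v] D by (simp add: algebra_simps)
      moreover have "0 \<le> out_err P (E t) * dis t"
      proof -
        have "out_err P (E t) * dis t = \<beta> * (out_err P (E t))\<^sup>2 * ((r t)\<^sup>2 + (norm (xh t - E t))\<^sup>2)"
          by (simp add: dis_def power2_eq_square)
        then show ?thesis using gains by simp
      qed
      then have "0 \<le> 2 * b * (out_err P (E t) * dis t)" using b by simp
      moreover have "a * W t \<le> c * (norm (E t))\<^sup>2"
        using mult_left_mono[OF WN[of t], of a] a N(1) by (simp add: a_def)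
      ultimately show "w t + D t + a * W t \<le> 0" using c(2)[OF K, of "E t"] by linarith
    qed
  qed
  from abs_cont_deriv_nonpos_imp_antimono[OF V this, of 0]
  have decay: "W t + U t + integral {0..t} (\<lambda>t. a * W t) \<le> W 0 + U 0" if "0 \<le> t" for t
    using that by simp
  have int0: "0 \<le> integral {0..t} W" for t
    using W0 contW by (intro integral_nonneg integrable_continuous_interval) auto
  have int: "integral {0..t} W \<le> (W 0 + U 0) / a" and le: "W t \<le> W 0 + U 0" "U t \<le> W 0 + U 0"
    if "0 \<le> t" for t
  proof -
    have "0 \<le> a * integral {0..t} W" using a int0[of t] by simp
    moreover have *: "W t + U t + a * integral {0..t} W \<le> W 0 + U 0" using decay[OF that] by simp
    ultimately show "W t \<le> W 0 + U 0" "U t \<le> W 0 + U 0" using U0[of t] W0[of t] by linarith+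
    have "a * integral {0..t} W \<le> W 0 + U 0" using * U0[of t] W0[of t] by linarith
    then show "integral {0..t} W \<le> (W 0 + U 0) / a" using a by (simp add: field_simps)
  qed

  obtain B where B: "0 \<le> B"
    "\<And>z s sh. gain_energy m mh (b / \<alpha>) (b / \<rho>) q z \<le> W 0 + U 0 \<Longrightarrow> (\<And>j. j \<in> {1..<m} \<Longrightarrow> \<bar>s j\<bar> \<le> 1) \<Longrightarrow>
        (\<And>k. k \<in> {1..<mh} \<Longrightarrow> \<bar>sh k\<bar> \<le> 1) \<Longrightarrow>
        \<bar>kR z - kR q\<bar> \<le> B \<and> norm (feedback_gain m mh s sh z - feedback_gain m mh s sh q) \<le> B \<and>
        \<bar>affine_gain m mh s sh z - affine_gain m mh s sh q\<bar> \<le> B"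
    using gain_energy_bounds_gains[of "b / \<alpha>" "b / \<rho>"] b gains by (metis divide_pos_pos)
  \<comment> \<open>The square root bounds \<open>norm (E t)\<close> through \<open>p\<close>, and
    \<open>N\<close> bounds the action of \<open>P\<close>; \<open>e_last\<close> has norm
    1.\<close>
  define Y where "Y = sqrt ((W 0 + U 0) / p) * N"
  have Y: "\<bar>out_err P (E t)\<bar> \<le> Y" if "0 \<le> t" for t
  proof -
    have "p * (norm (E t))\<^sup>2 \<le> W 0 + U 0" using Wp[of t] le(1)[OF that] by simp
    then have "norm (E t) \<le> sqrt ((W 0 + U 0) / p)"
      using p(1) by (intro real_le_rsqrt) (simp add: field_simps)
    then have "norm (E t) * N \<le> Y" unfolding Y_def using N(1) by (intro mult_right_mono) auto
    moreover have "\<bar>out_err P (E t)\<bar> \<le> norm (e_last :: 'n rvec) * norm (P *v E t)"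
      unfolding out_err_def by (rule Cauchy_Schwarz_ineq2)
    ultimately show ?thesis using N(2)[of "E t"] by (simp add: e_last_def)
  qed
  define C where "C = 2 * b * (B\<^sup>2 / (2 * \<beta>) + Y * B)"
  \<comment> \<open>Without \<open>D\<close> the term in \<open>\<phi>\<close> no longer cancels,
    and it contains \<open>r t\<close> and the plant state, which may be unbounded. The damping
    \<open>dis\<close> absorbs them through \<open>input_bound\<close>, and the drift term is
    nonpositive.\<close>
  have wC: "AE t in lebesgue. 0 \<le> t \<longrightarrow> w t + (- C) \<le> 0"
    using rates
  proof eventually_elim
    case (elim t)
    show ?case
    proof
      assume t: "0 \<le> t"
      then obtain K s sh \<phi> where K: "K < mh" and good: "good t s sh \<phi>"
        and v: "v t = sysmat R K *v E t - (b * (\<phi> + dis t)) *\<^sub>R e_last" using elim by blast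
      have "\<bar>s j\<bar> \<le> 1" if "j \<in> {1..<m}" for j using good that by (simp add: good_def)
      moreover have "\<bar>sh k\<bar> \<le> 1" for k using good by (simp add: good_def)
      ultimately have "\<bar>kR (z t) - kR q\<bar> \<le> B"
        "norm (feedback_gain m mh s sh (z t) - feedback_gain m mh s sh q) \<le> B"
        "\<bar>affine_gain m mh s sh (z t) - affine_gain m mh s sh q\<bar> \<le> B"
        using B(2)[OF le(2)[OF t, unfolded U_def[of t]], of s sh] by blast+
      from input_bound[OF gains(2) this Y[OF t], of "r t" "xh t - E t"]
      have "- (out_err P (E t) * (\<phi> + dis t)) \<le> B\<^sup>2 / (2 * \<beta>) + Y * B"
        using good by (simp add: good_def dis_def)
      then have "2 * b * - (out_err P (E t) * (\<phi> + dis t)) \<le> C"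
        unfolding C_def using b by (intro mult_left_mono) auto
      moreover have "2 * ((P *v E t) \<bullet> (sysmat R K *v E t)) \<le> 0"
        using c(2)[OF K, of "E t"] c(1) by (smt (verit) mult_nonneg_nonneg zero_le_power2 mult_minus_left)
      ultimately show "w t + (- C) \<le> 0" unfolding w_eq[OF v] by (simp add: algebra_simps)
    qed
  qed
  \<comment> \<open>Subtracting the line of slope \<open>C\<close> turns the upper bound on
    \<open>w\<close> into monotonicity, that is, into the growth condition on
    \<open>W\<close>.\<close>
  have "abs_cont_deriv (\<lambda>t. W t + - C * t) (\<lambda>t. w t + (- C))"
    by (intro abs_cont_deriv_add w) (auto simp: abs_cont_deriv_def)
  from abs_cont_deriv_nonpos_imp_antimono[OF this wC]
  have growth: "W t \<le> W s + C * (t - s)" if "0 \<le> s" "s \<le> t" for s t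
    using that by (fastforce simp: algebra_simps)
  have "(W \<longlongrightarrow> 0) at_top"
    by (rule barbalat_one_sided[OF contW W0 growth int])
  then have "((\<lambda>t. W t / p) \<longlongrightarrow> 0) at_top" by (rule tendsto_divide_zero)
  then have "((\<lambda>t. (norm (E t))\<^sup>2) \<longlongrightarrow> 0) at_top"
    by (rule tendsto_sandwich[OF _ _ tendsto_const, rotated 2])
      (use Wp p(1) in \<open>auto simp: field_simps intro!: always_eventually\<close>)
  then have "((\<lambda>t. sqrt ((norm (E t))\<^sup>2)) \<longlongrightarrow> sqrt 0) at_top" by (rule tendsto_real_sqrt)
  then show ?thesis unfolding E_def by (simp add: tendsto_norm_zero_iff)
qed

end
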